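(* Let $n\ge 3$ and $m\ge 2$ be integers. The Schur multiplier $M(\mathrm{UT}_n(\mathbb Z/m\mathbb Z))=H_2(\mathrm{UT}_n(\mathbb Z/m\mathbb Z),\mathbb Z)$ is isomorphic to $$(\mathbb Z/m\mathbb Z)^{\binom{n}{2}-1}\ \text{ if $m$ is odd},\qquad (\mathbb Z/2\mathbb Z)^{n-3}\oplus(\mathbb Z/\tfrac m2\mathbb Z)^{n-2}\oplus(\mathbb Z/m\mathbb Z)^{\binom{n-1}{2}}\ \text{ if $m$ is even}.$$
   Context: $\mathrm{UT}_n(A)$ denotes the group of upper unitriangular $n\times n$ matrices over a ring $A$. *)

theory Defs
  imports "HOL-Algebra.Algebra"
begin

(* Integral group homology H_2(G,Z) of a finite group G, computed from the
   (inhomogeneous) bar complex with trivial coefficients Z: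
     C_k = free abelian group on G^k (here: integer functions on G^k),
     d[g|h]   = [h] - [gh] + [g],
     d[g|h|k] = [h|k] - [gh|k] + [g|hk] - [g|h],
     H_2 = ker d_2 / im d_3.                                              *)

definition chains1 :: "('a, 'b) monoid_scheme \<Rightarrow> ('a \<Rightarrow> int) set" where
  "chains1 G = {f. \<forall>x. x \<notin> carrier G \<longrightarrow> f x = 0}"

definition chains2 :: "('a, 'b) monoid_scheme \<Rightarrow> ('a \<times> 'a \<Rightarrow> int) set" where
  "chains2 G = {f. \<forall>x. x \<notin> carrier G \<times> carrier G \<longrightarrow> f x = 0}"

definition chains3 :: "('a, 'b) monoid_scheme \<Rightarrow> ('a \<times> 'a \<times> 'a \<Rightarrow> int) set" where
  "chains3 G = {f. \<forall>x. x \<notin> carrier G \<times> carrier G \<times> carrier G \<longrightarrow> f x = 0}"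

definition bar_d2 :: "('a, 'b) monoid_scheme \<Rightarrow> ('a \<times> 'a \<Rightarrow> int) \<Rightarrow> ('a \<Rightarrow> int)" where
  "bar_d2 G f = (\<lambda>x. if x \<in> carrier G then
      (\<Sum>(g,h)\<in>carrier G \<times> carrier G. f (g,h) *
         ((if h = x then 1 else 0) - (if g \<otimes>\<^bsub>G\<^esub> h = x then 1 else 0) + (if g = x then 1 else 0)))
    else 0)"

definition bar_d3 :: "('a, 'b) monoid_scheme \<Rightarrow> ('a \<times> 'a \<times> 'a \<Rightarrow> int) \<Rightarrow> ('a \<times> 'a \<Rightarrow> int)" where
  "bar_d3 G f = (\<lambda>y. if y \<in> carrier G \<times> carrier G then
      (\<Sum>(g,h,k)\<in>carrier G \<times> carrier G \<times> carrier G. f (g,h,k) *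
         ((if (h,k) = y then 1 else 0) - (if (g \<otimes>\<^bsub>G\<^esub> h, k) = y then 1 else 0)
          + (if (g, h \<otimes>\<^bsub>G\<^esub> k) = y then 1 else 0) - (if (g,h) = y then 1 else 0)))
    else 0)"

definition cycles2 :: "('a, 'b) monoid_scheme \<Rightarrow> ('a \<times> 'a \<Rightarrow> int) set" where
  "cycles2 G = {f \<in> chains2 G. bar_d2 G f = (\<lambda>_. 0)}"

definition boundaries2 :: "('a, 'b) monoid_scheme \<Rightarrow> ('a \<times> 'a \<Rightarrow> int) set" where
  "boundaries2 G = bar_d3 G ` chains3 G"

definition cycles2_group :: "('a, 'b) monoid_scheme \<Rightarrow> ('a \<times> 'a \<Rightarrow> int) monoid" where
  "cycles2_group G = \<lparr>carrier = cycles2 G, monoid.mult = (\<lambda>f g x. f x + g x), one = (\<lambda>_. 0)\<rparr>"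

definition schur_multiplier :: "('a, 'b) monoid_scheme \<Rightarrow> ('a \<times> 'a \<Rightarrow> int) set monoid" where
  "schur_multiplier G = cycles2_group G Mod boundaries2 G"

definition UT :: "nat \<Rightarrow> int \<Rightarrow> (nat \<Rightarrow> nat \<Rightarrow> int) monoid" where
  "UT n m = \<lparr>carrier = {A. \<forall>i j. A i j \<in>
        (if i < n \<and> j < n then (if i < j then {0..<m} else if i = j then {1} else {0}) else {0})},
     monoid.mult = (\<lambda>A B i j. if i < n \<and> j < n then (\<Sum>k<n. A i k * B k j) mod m else 0),
     one = (\<lambda>i j. if i < n \<and> i = j then 1 else 0)\<rparr>"

definition cyc_prod :: "int list \<Rightarrow> (nat \<Rightarrow> int) monoid" where
  "cyc_prod ds = \<lparr>carrier = {v. \<forall>i. (i < length ds \<longrightarrow> 0 \<le> v i \<and> v i < ds ! i)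
                                   \<and> (length ds \<le> i \<longrightarrow> v i = 0)},
     monoid.mult = (\<lambda>v w i. if i < length ds then (v i + w i) mod (ds ! i) else 0),
     one = (\<lambda>_. 0)\<rparr>"

end

theory Submission
  imports Defs "HOL-Library.Function_Algebras"
begin

text \<open>For commuting $x,y$ let $\tau(x,y) = [x|y] - [y|x]$, and let $e_{ij}$ be the elementary
  matrices. Modulo boundaries $\tau$ is biadditive and invariant under conjugation, which bounds the
  orders of the classes $\tau(e_{i,i+1}, e_{j,j+1})$ with $j \ge i+2$, $\tau(e_{i,i+2}, e_{i,i+1})$,
  $\tau(e_{i,i+2}, e_{i+1,i+2})$ and $\tau(e_{i,i+2}, e_{i+1,i+3})$; the only further relation, for
  even $m$, is $\frac m2 (\tau(e_{i,i+2}, e_{i,i+1}) + \tau(e_{i,i+2}, e_{i+1,i+2})) = 0$.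

  These classes generate: divide the chains by the boundaries and by these classes, and take the
  central extension of $\mathrm{UT}_n(\mathbb Z/m)$ given by the tautological cocycle $[g|h]$. In it
  iterated commutators of lifts of the $e_{i,i+1}$ satisfy the Steinberg relations, so that they
  define a homomorphism from $\mathrm{UT}_n(\mathbb Z)$. Hence $[g|h]$ is a coboundary up to the
  carries of the superdiagonal entries, and these vanish on cycles since they are rational
  coboundaries.

  Explicit cocycles, with values in $\mathbb Z/m$, $\mathbb Z/\frac m2$ and $\mathbb Z/2$, are dual to
  these generators, so there are no further relations.\<close>

section \<open>Cocycles modulo a subgroup of the coefficients\<close>

text \<open>In the application the coefficients are the chains themselves and \<open>u g h\<close>
  is the chain [g|h]. Pairing this universal cocycle with a cycle f returns f, so a formula for
  \<open>u\<close> modulo \<open>H\<close> becomes membership of f in \<open>H\<close>. Keeping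
  \<open>H\<close> as a variable subgroup lets generation be stated as: every subgroup containing
  the boundaries and the generators contains all cycles. The ring structure supplies the scalar
  multiples \<open>of_int k * x\<close>. Parity enters through \<open>m choose 2\<close>, a multiple
  of m exactly when m is odd. It is the exponent in class-3 commutator expansions, which produces
  the relation with factor m/2. It returns on the dual side, where the Massey products <x,x,y> and
  <x,y,y> involve binomials of integer representatives and, for even m, fail to be cocycles modulo m
  by multiples of m/2. The 2-torsion of the crossing classes has another source: two conjugations
  express the same class with opposite signs.\<close>

locale cocycle_mod = group G for G (structure) +
  fixes u :: "'a \<Rightarrow> 'a \<Rightarrow> 'm :: comm_ring_1" and H :: "'m set"
  assumes H_zero: "0 \<in> H"
    and H_diff: "x \<in> H \<Longrightarrow> y \<in> H \<Longrightarrow> x - y \<in> H"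
    and cocycle: "g \<in> carrier G \<Longrightarrow> h \<in> carrier G \<Longrightarrow> k \<in> carrier G \<Longrightarrow>
      u h k - u (g \<otimes> h) k + u g (h \<otimes> k) - u g h \<in> H"
begin

lemma H_uminus: "x \<in> H \<Longrightarrow> - x \<in> H"
  using H_diff[OF H_zero] by fastforce

lemma H_add: "x \<in> H \<Longrightarrow> y \<in> H \<Longrightarrow> x + y \<in> H"
  using H_diff[of x "- y"] H_uminus by simp

lemma H_of_nat_mult: "x \<in> H \<Longrightarrow> of_nat k * x \<in> H"
  by (induction k) (auto simp: H_zero H_add distrib_right)

lemma H_of_int_mult: "x \<in> H \<Longrightarrow> of_int k * x \<in> H"
  by (cases k) (auto simp: H_of_nat_mult H_uminus simp del: of_nat_Suc)

text \<open>For commuting x and y this is the commutator of arbitrary lifts of x and y to the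
  central extension (\<open>lift_commutator\<close>).\<close>

definition tau where "tau x y = u x y - u y x"

lemma tau_swap: "tau y x = - tau x y"
  by (simp add: tau_def)

text \<open>The cocycle identities for (x,y,z) and (y,z,x) minus the one for (y,x,z) carry x across
  the pair (y,z). Only \<open>tau\<close> terms survive.\<close>

lemma tau_mult:
  assumes [simp]: "x \<in> carrier G" "y \<in> carrier G" "z \<in> carrier G"
    and c: "x \<otimes> y = y \<otimes> x" "x \<otimes> z = z \<otimes> x"
  shows "tau x (y \<otimes> z) - tau x y - tau x z \<in> H"
proof -
  have "(u y z - u (x \<otimes> y) z + u x (y \<otimes> z) - u x y)
      + (u z x - u (y \<otimes> z) x + u y (z \<otimes> x) - u y z)
      - (u x z - u (y \<otimes> x) z + u y (x \<otimes> z) - u y x) \<in> H"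
    by (intro H_add H_diff cocycle) auto
  then show ?thesis
    by (simp add: tau_def c algebra_simps)
qed

lemma tau_mult_left:
  assumes "x \<in> carrier G" "y \<in> carrier G" "z \<in> carrier G"
    and "y \<otimes> x = x \<otimes> y" "z \<otimes> x = x \<otimes> z"
  shows "tau (y \<otimes> z) x - tau y x - tau z x \<in> H"
proof -
  have "- (tau x (y \<otimes> z) - tau x y - tau x z) \<in> H"
    using assms by (intro H_uminus tau_mult) simp_all
  then show ?thesis
    by (simp add: tau_swap[of _ x] algebra_simps)
qed

lemma tau_one: assumes [simp]: "x \<in> carrier G" shows "tau x \<one> \<in> H"
  using H_uminus[OF tau_mult[of x \<one> \<one>]] by simp

lemma tau_pow:
  assumes [simp]: "x \<in> carrier G" "y \<in> carrier G" and c: "x \<otimes> y = y \<otimes> x"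
  shows "tau x (y [^] (k::nat)) - of_nat k * tau x y \<in> H"
proof (induction k)
  case 0
  then show ?case by (simp add: tau_one)
next
  case (Suc k)
  have "x \<otimes> y [^] k = y [^] k \<otimes> x"
    using pow_mult_distrib c by (metis assms group_commutes_pow)
  from H_add[OF tau_mult[OF _ _ _ this c] Suc] show ?case
    by (simp add: algebra_simps)
qed

lemma tau_torsion:
  assumes "x \<in> carrier G" "y \<in> carrier G" "x \<otimes> y = y \<otimes> x" "y [^] (k::nat) = \<one>"
  shows "of_nat k * tau x y \<in> H"
  using H_diff[OF tau_one[of x] tau_pow[of x y k]] assms by simp

text \<open>The triples (g,y,x), (y',g,x), (y',x',g), with alternating signs, form the prism between
  [y|x] and [y'|x']. Subtracting the prism for the swapped pair cancels every term containing
  g.\<close>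

lemma tau_conj:
  assumes [simp]: "g \<in> carrier G" "x \<in> carrier G" "y \<in> carrier G" "x' \<in> carrier G" "y' \<in> carrier G"
    and gx: "g \<otimes> x = x' \<otimes> g" and gy: "g \<otimes> y = y' \<otimes> g" and c: "x \<otimes> y = y \<otimes> x"
  shows "tau x' y' - tau x y \<in> H"
proof -
  have 1: "x' \<otimes> y' \<otimes> g = g \<otimes> (x \<otimes> y)"
    by (metis gx gy m_assoc assms(1-5))
  have 2: "y' \<otimes> x' \<otimes> g = g \<otimes> (y \<otimes> x)"
    by (metis gx gy m_assoc assms(1-5))
  have c': "x' \<otimes> y' = y' \<otimes> x'"
    by (rule right_cancel[of g, THEN iffD1]) (simp_all add: 1 2 c)
  have "(u y x - u (g \<otimes> y) x + u g (y \<otimes> x) - u g y)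
      - (u g x - u (y' \<otimes> g) x + u y' (g \<otimes> x) - u y' g)
      + (u x' g - u (y' \<otimes> x') g + u y' (x' \<otimes> g) - u y' x') 
      - ((u x y - u (g \<otimes> x) y + u g (x \<otimes> y) - u g x)
      - (u g y - u (x' \<otimes> g) y + u x' (g \<otimes> y) - u x' g)
      + (u y' g - u (x' \<otimes> y') g + u x' (y' \<otimes> g) - u x' y'))\<in> H"
    by (intro H_add H_diff cocycle) auto
  then show ?thesis
    by (simp add: tau_def c c' gx gy algebra_simps)
qed

text \<open>Modulo \<open>H\<close>, \<open>tau x\<close> is additive on the centralizer of x, so it
  kills the commutator c of the two elements a and b of that centralizer.\<close>

lemma tau_commutator:
  assumes [simp]: "x \<in> carrier G" "a \<in> carrier G" "b \<in> carrier G" "c \<in> carrier G"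
    and ab: "a \<otimes> b = c \<otimes> b \<otimes> a"
    and xa: "x \<otimes> a = a \<otimes> x" and xb: "x \<otimes> b = b \<otimes> x" and xc: "x \<otimes> c = c \<otimes> x"
  shows "tau x c \<in> H"
proof -
  have "x \<otimes> (b \<otimes> a) = b \<otimes> a \<otimes> x"
    by (metis xa xb m_assoc assms(1-3))
  then have "(tau x (a \<otimes> b) - tau x a - tau x b) - (tau x (c \<otimes> (b \<otimes> a)) - tau x c - tau x (b \<otimes> a))
      - (tau x (b \<otimes> a) - tau x b - tau x a) \<in> H"
    using xa xb xc by (intro H_diff tau_mult) simp_all
  then show ?thesis
    by (simp add: ab m_assoc)
qed

text \<open>In $\mathrm{UT}_4$ take $p,q,r,s = e_{13}, e_{23}, e_{14}, e_{24}$, $f = e_{12}$, $g = e_{34}$: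
  conjugation by $g$ gives $\tau(p,s) = -\tau(r,q)$, conjugation by $f$ gives
  $\tau(p,s) = -\tau(q,r)$.\<close>

lemma tau_crossing:
  assumes [simp]: "f \<in> carrier G" "g \<in> carrier G" "p \<in> carrier G" "q \<in> carrier G"
    "r \<in> carrier G" "s \<in> carrier G"
    and gp: "g \<otimes> (p \<otimes> r) = p \<otimes> g" and gq: "g \<otimes> (q \<otimes> s) = q \<otimes> g"
    and fq: "f \<otimes> q = p \<otimes> q \<otimes> f" and fs: "f \<otimes> s = r \<otimes> s \<otimes> f"
    and c: "p \<otimes> q = q \<otimes> p" "p \<otimes> r = r \<otimes> p" "p \<otimes> s = s \<otimes> p" "q \<otimes> r = r \<otimes> q" "q \<otimes> s = s \<otimes> q"
      "r \<otimes> s = s \<otimes> r"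
    and rs: "tau r s \<in> H" and pr: "tau p r \<in> H"
  shows "tau p s + tau r q \<in> H" and "tau p s + tau q r \<in> H"
proof -
  have expand: "tau (x \<otimes> y) (z \<otimes> w) - tau x z - tau x w - tau y z - tau y w \<in> H"
    if [simp]: "x \<in> carrier G" "y \<in> carrier G" "z \<in> carrier G" "w \<in> carrier G"
      and d: "x \<otimes> z = z \<otimes> x" "x \<otimes> w = w \<otimes> x" "y \<otimes> z = z \<otimes> y" "y \<otimes> w = w \<otimes> y" for x y z w
  proof -
    have "x \<otimes> (z \<otimes> w) = z \<otimes> w \<otimes> x" "y \<otimes> (z \<otimes> w) = z \<otimes> w \<otimes> y"
      by (metis d m_assoc that(1-4))+
    from tau_mult_left[OF _ _ _ this]
    have "tau (x \<otimes> y) (z \<otimes> w) - tau x (z \<otimes> w) - tau y (z \<otimes> w) \<in> H" by simp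
    from H_add[OF this H_add[OF tau_mult[OF _ _ _ d(1,2)] tau_mult[OF _ _ _ d(3,4)]]]
    show ?thesis by (simp add: algebra_simps)
  qed
  have comm: "x \<otimes> y \<otimes> (z \<otimes> w) = z \<otimes> w \<otimes> (x \<otimes> y)"
    if [simp]: "x \<in> carrier G" "y \<in> carrier G" "z \<in> carrier G" "w \<in> carrier G"
      and d: "x \<otimes> z = z \<otimes> x" "x \<otimes> w = w \<otimes> x" "y \<otimes> z = z \<otimes> y" "y \<otimes> w = w \<otimes> y" for x y z w
    by (smt (verit) d m_assoc m_closed that(1-4))
  have "tau p q - tau (p \<otimes> r) (q \<otimes> s) \<in> H"
    by (rule tau_conj[of g]) (simp_all add: gp gq, rule comm, simp_all add: c)
  from H_add[OF this expand[of p r q s]] show "tau p s + tau r q \<in> H"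
    using H_uminus[OF H_add[OF _ rs]] by (fastforce simp: c algebra_simps)
  have "tau (p \<otimes> q) (r \<otimes> s) - tau q s \<in> H"
    by (rule tau_conj[of f]) (simp_all add: fq fs c)
  from H_diff[OF this expand[of p q r s]] show "tau p s + tau q r \<in> H"
    using H_diff[OF _ pr] by (fastforce simp: c algebra_simps)
qed

subsection \<open>The associated central extension\<close>

text \<open>Chosen coset representatives play the role of the quotient of the coefficients by
  \<open>H\<close>.\<close>

definition rep where "rep x = (SOME y. y - x \<in> H)"

lemma rep_diff: "rep x - x \<in> H"
  unfolding rep_def by (rule someI[of _ x]) (simp add: H_zero)

lemma rep_eq_iff: "rep x = rep y \<longleftrightarrow> x - y \<in> H"
proof
  assume "rep x = rep y"
  then show "x - y \<in> H"
    using H_diff[OF rep_diff[of y] rep_diff[of x]] by simp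
next
  assume *: "x - y \<in> H"
  have "z - x \<in> H \<longleftrightarrow> z - y \<in> H" for z
    using H_add[OF _ *, of "z - x"] H_diff[OF _ *, of "z - y"] by auto
  then show "rep x = rep y" by (simp add: rep_def)
qed

lemma rep_idem [simp]: "rep (rep x) = rep x"
  by (simp add: rep_eq_iff rep_diff)

text \<open>Central extension of G by the coefficients modulo \<open>H\<close>. The cocycle need not
  be normalized, hence the offset in the identity element.\<close>

definition ext_group :: "('m \<times> 'a) monoid" where
  "ext_group = \<lparr>carrier = {(x, g). rep x = x \<and> g \<in> carrier G},
     monoid.mult = (\<lambda>(x, g) (y, h). (rep (x + y + u g h), g \<otimes> h)),
     one = (rep (- u \<one> \<one>), \<one>)\<rparr>"

definition lift where "lift x g = (rep x, g)"

lemma lift_in_carrier [simp]: "g \<in> carrier G \<Longrightarrow> lift x g \<in> carrier ext_group"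
  by (simp add: lift_def ext_group_def)

lemma carrier_ext_groupE:
  assumes "e \<in> carrier ext_group"
  obtains x g where "e = lift x g" "g \<in> carrier G"
proof (rule that)
  show "e = lift (fst e) (snd e)" "snd e \<in> carrier G"
    using assms by (auto simp: lift_def ext_group_def)
qed

lemma lift_mult: "lift x g \<otimes>\<^bsub>ext_group\<^esub> lift y h = lift (x + y + u g h) (g \<otimes> h)"
proof -
  have "rep x + rep y + u g h - (x + y + u g h) \<in> H"
    using H_add[OF rep_diff[of x] rep_diff[of y]] by (simp add: algebra_simps)
  then show ?thesis by (simp add: lift_def ext_group_def rep_eq_iff)
qed

lemma lift_eq_iff: "lift x g = lift y h \<longleftrightarrow> x - y \<in> H \<and> g = h"
  by (auto simp: lift_def rep_eq_iff)

lemma ext_one: "\<one>\<^bsub>ext_group\<^esub> = lift (- u \<one> \<one>) \<one>"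
  by (simp add: ext_group_def lift_def)

lemma u_one: assumes "g \<in> carrier G" shows "u \<one> g - u \<one> \<one> \<in> H" "u g \<one> - u \<one> \<one> \<in> H"
  using cocycle[of \<one> \<one> g] H_uminus[OF cocycle[of g \<one> \<one>]] assms by auto

lemma group_ext_group: "group ext_group"
proof (rule groupI)
  fix x y assume "x \<in> carrier ext_group" "y \<in> carrier ext_group"
  then show "x \<otimes>\<^bsub>ext_group\<^esub> y \<in> carrier ext_group"
    by (elim carrier_ext_groupE) (simp add: lift_mult)
next
  show "\<one>\<^bsub>ext_group\<^esub> \<in> carrier ext_group" by (simp add: ext_one)
next
  fix e f k assume "e \<in> carrier ext_group" "f \<in> carrier ext_group" "k \<in> carrier ext_group"
  then obtain x g y h z k' where "e = lift x g" "f = lift y h" "k = lift z k'"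
    and [simp]: "g \<in> carrier G" "h \<in> carrier G" "k' \<in> carrier G"
    by (elim carrier_ext_groupE)
  then show "e \<otimes>\<^bsub>ext_group\<^esub> f \<otimes>\<^bsub>ext_group\<^esub> k = e \<otimes>\<^bsub>ext_group\<^esub> (f \<otimes>\<^bsub>ext_group\<^esub> k)"
    using H_uminus[OF cocycle[of g h k']]
    by (simp add: lift_mult lift_eq_iff m_assoc algebra_simps)
next
  fix e assume "e \<in> carrier ext_group"
  then obtain x g where [simp]: "e = lift x g" "g \<in> carrier G" by (elim carrier_ext_groupE)
  show "\<one>\<^bsub>ext_group\<^esub> \<otimes>\<^bsub>ext_group\<^esub> e = e"
    using u_one(1)[of g] by (simp add: ext_one lift_mult lift_eq_iff)
  show "\<exists>f\<in>carrier ext_group. f \<otimes>\<^bsub>ext_group\<^esub> e = \<one>\<^bsub>ext_group\<^esub>"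
    by (rule bexI[of _ "lift (- x - u (inv g) g - u \<one> \<one>) (inv g)"])
       (simp_all add: ext_one lift_mult lift_eq_iff H_zero)
qed

lemma lift_one_central:
  assumes "e \<in> carrier ext_group"
  shows "lift x \<one> \<otimes>\<^bsub>ext_group\<^esub> e = e \<otimes>\<^bsub>ext_group\<^esub> lift x \<one>"
proof -
  obtain y g where [simp]: "e = lift y g" "g \<in> carrier G" using assms by (elim carrier_ext_groupE)
  show ?thesis using H_diff[OF u_one[of g]] by (simp add: lift_mult lift_eq_iff algebra_simps)
qed

lemma lift_commute_iff:
  assumes "g \<otimes> h = h \<otimes> g"
  shows "lift x g \<otimes>\<^bsub>ext_group\<^esub> lift y h = lift y h \<otimes>\<^bsub>ext_group\<^esub> lift x g \<longleftrightarrow> tau g h \<in> H"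
  by (simp add: lift_mult lift_eq_iff assms tau_def algebra_simps)

lemma snd_lift [simp]: "snd (lift x g) = g"
  by (simp add: lift_def)

lemma snd_hom: "group_hom ext_group G snd"
  by (intro group_hom.intro group_hom_axioms.intro group_ext_group homI)
     (auto simp: lift_mult elim!: carrier_ext_groupE)

end

section \<open>Commutator calculus\<close>

context group
begin

lemma conj_int_pow:
  assumes [simp]: "x \<in> carrier G" "y \<in> carrier G" "z \<in> carrier G" and xy: "x \<otimes> y = z \<otimes> x"
  shows "x \<otimes> y [^] (t::int) = z [^] t \<otimes> x"
proof -
  have nat: "x \<otimes> y [^] k = z [^] k \<otimes> x" for k :: nat
  proof (induction k)
    case (Suc k)
    have "x \<otimes> y [^] Suc k = x \<otimes> y [^] k \<otimes> y" by (simp add: m_assoc)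
    also have "\<dots> = z [^] k \<otimes> (x \<otimes> y)" by (simp add: Suc m_assoc)
    finally show ?case by (simp add: xy m_assoc)
  qed simp
  show ?thesis
  proof (cases t)
    case (nonneg k)
    then show ?thesis using nat by (simp add: int_pow_int)
  next
    case (neg k)
    have "x = z [^] Suc k \<otimes> x \<otimes> inv (y [^] Suc k)"
      by (metis assms(1,2) inv_solve_right m_closed nat nat_pow_closed)
    then have "inv (z [^] Suc k) \<otimes> x = x \<otimes> inv (y [^] Suc k)"
      by (metis assms inv_solve_left m_assoc m_closed nat_pow_closed inv_closed)
    then show ?thesis unfolding neg by (simp add: int_pow_neg_int del: of_nat_Suc nat_pow_Suc)
  qed
qed

lemma commutator_nat_pow:
  assumes [simp]: "x \<in> carrier G" "y \<in> carrier G" "w \<in> carrier G"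
    and xy: "x \<otimes> y = w \<otimes> y \<otimes> x" and wx: "w \<otimes> x = x \<otimes> w"
  shows "x [^] (k::nat) \<otimes> y = w [^] k \<otimes> y \<otimes> x [^] k"
proof (induction k)
  case (Suc k)
  have "x [^] Suc k \<otimes> y = x [^] k \<otimes> w \<otimes> (y \<otimes> x)" by (simp add: xy m_assoc)
  also have "x [^] k \<otimes> w = w \<otimes> x [^] k" using group_commutes_pow[of x w k] wx by simp
  also have "w \<otimes> x [^] k \<otimes> (y \<otimes> x) = w \<otimes> (x [^] k \<otimes> y) \<otimes> x" by (simp add: m_assoc)
  also have "\<dots> = (w \<otimes> w [^] k) \<otimes> y \<otimes> (x [^] k \<otimes> x)" by (simp add: Suc m_assoc)
  also have "w \<otimes> w [^] k = w [^] Suc k" using nat_pow_Suc2[of w k] by simp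
  finally show ?case by simp
qed simp

text \<open>The commutator w is central in the subgroup generated by x and y, so commutators of
  powers are bilinear in the exponents.\<close>

lemma commutator_int_pow:
  assumes [simp]: "x \<in> carrier G" "y \<in> carrier G" "w \<in> carrier G"
    and xy: "x \<otimes> y = w \<otimes> y \<otimes> x" and wx: "w \<otimes> x = x \<otimes> w" and wy: "w \<otimes> y = y \<otimes> w"
  shows "x [^] (a::int) \<otimes> y [^] (t::int) = w [^] (a * t) \<otimes> y [^] t \<otimes> x [^] a"
proof -
  have "x \<otimes> y [^] t = (w \<otimes> y) [^] t \<otimes> x"
    by (rule conj_int_pow) (simp_all add: xy)
  moreover have "(w \<otimes> y) [^] t = w [^] t \<otimes> y [^] t"
    by (rule int_pow_mult_distrib[OF wy]) simp_all
  ultimately have 1: "x \<otimes> y [^] t = w [^] t \<otimes> y [^] t \<otimes> x" by (simp only:)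
  have wt: "w [^] t \<otimes> y [^] t = y [^] t \<otimes> w [^] t"
    using conj_int_pow[of "w [^] t" y y t] conj_int_pow[of y w w t] wy by simp
  have wx': "w [^] t \<otimes> x = x \<otimes> w [^] t"
    using conj_int_pow[of x w w t] wx by simp
  have "y [^] t \<otimes> (w [^] t \<otimes> x) = x \<otimes> y [^] t"
    by (simp add: 1 wt m_assoc)
  then have "y [^] t \<otimes> (w [^] t \<otimes> x) [^] a = x [^] a \<otimes> y [^] t"
    by (intro conj_int_pow) simp_all
  also have "(w [^] t \<otimes> x) [^] a = w [^] (t * a) \<otimes> x [^] a"
    using int_pow_mult_distrib[OF wx', of a] by (simp add: int_pow_pow)
  finally have "x [^] a \<otimes> y [^] t = y [^] t \<otimes> (w [^] (t * a) \<otimes> x [^] a)" ..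
  also have "\<dots> = (y [^] t \<otimes> w [^] (t * a)) \<otimes> x [^] a" by (simp add: m_assoc)
  also have "y [^] t \<otimes> w [^] (t * a) = w [^] (t * a) \<otimes> y [^] t"
    using conj_int_pow[of "w [^] (t * a)" y y t] conj_int_pow[of y w w "t * a"] wy by simp
  finally show ?thesis by (simp add: mult.commute)
qed

lemma central_nat_pow:
  assumes "c \<in> carrier G" "\<And>y. y \<in> carrier G \<Longrightarrow> c \<otimes> y = y \<otimes> c" "y \<in> carrier G"
  shows "c [^] (k::nat) \<otimes> y = y \<otimes> c [^] k"
  using assms by (intro group_commutes_pow) auto

text \<open>Here $z = [x,y]$, $p = [x,z]$ and $q = [y,z]$, so that expanding $x^k y$ and $x y^k$ in the free
  nilpotent group of class 3 produces the binomial exponents.\<close>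

lemma class3_pow:
  assumes [simp]: "x \<in> carrier G" "y \<in> carrier G" "z \<in> carrier G" "p \<in> carrier G" "q \<in> carrier G"
    and xy: "x \<otimes> y = z \<otimes> y \<otimes> x" and xz: "x \<otimes> z = p \<otimes> z \<otimes> x" and yz: "y \<otimes> z = q \<otimes> z \<otimes> y"
    and p: "\<And>g. g \<in> carrier G \<Longrightarrow> p \<otimes> g = g \<otimes> p"
    and q: "\<And>g. g \<in> carrier G \<Longrightarrow> q \<otimes> g = g \<otimes> q"
  shows "x [^] (k::nat) \<otimes> y = z [^] k \<otimes> p [^] (k choose 2) \<otimes> y \<otimes> x [^] k" (is ?A)
    and "x \<otimes> y [^] k = z [^] k \<otimes> q [^] (k choose 2) \<otimes> y [^] k \<otimes> x" (is ?B)
proof -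
  have zx: "x \<otimes> z [^] k = p [^] k \<otimes> z [^] k \<otimes> x" for k :: nat
  proof -
    have "x \<otimes> z [^] k = (p \<otimes> z) [^] k \<otimes> x"
      using conj_int_pow[of x z "p \<otimes> z" "int k"] xz by (simp add: int_pow_int)
    also have "(p \<otimes> z) [^] k = p [^] k \<otimes> z [^] k"
      by (rule pow_mult_distrib[OF p]) simp_all
    finally show ?thesis .
  qed
  have zy: "y [^] k \<otimes> z = q [^] k \<otimes> z \<otimes> y [^] k" for k :: nat
    by (rule commutator_nat_pow) (simp_all add: yz q)
  have c2: "Suc k choose 2 = k + (k choose 2)" for k
    by (simp add: numeral_2_eq_2)
  show ?A
  proof (induction k)
    case (Suc k)
    have "x [^] Suc k \<otimes> y = x \<otimes> (x [^] k \<otimes> y)" by (simp only: nat_pow_Suc2 m_assoc assms nat_pow_closed)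
    also have "\<dots> = (x \<otimes> z [^] k) \<otimes> p [^] (k choose 2) \<otimes> y \<otimes> x [^] k"
      by (simp add: Suc m_assoc)
    also have "\<dots> = p [^] k \<otimes> z [^] k \<otimes> (x \<otimes> p [^] (k choose 2)) \<otimes> y \<otimes> x [^] k"
      by (simp add: zx m_assoc)
    also have "x \<otimes> p [^] (k choose 2) = p [^] (k choose 2) \<otimes> x"
      using central_nat_pow[OF _ p, of x] by simp
    also have "p [^] k \<otimes> z [^] k \<otimes> (p [^] (k choose 2) \<otimes> x) \<otimes> y \<otimes> x [^] k
        = p [^] k \<otimes> (z [^] k \<otimes> p [^] (k choose 2)) \<otimes> (x \<otimes> y) \<otimes> x [^] k"
      by (simp add: m_assoc)
    also have "z [^] k \<otimes> p [^] (k choose 2) = p [^] (k choose 2) \<otimes> z [^] k"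
      using central_nat_pow[OF _ p, of "z [^] k"] by simp
    also have "p [^] k \<otimes> (p [^] (k choose 2) \<otimes> z [^] k) \<otimes> (x \<otimes> y) \<otimes> x [^] k
       = (p [^] k \<otimes> p [^] (k choose 2)) \<otimes> (z [^] k \<otimes> z) \<otimes> y \<otimes> (x \<otimes> x [^] k)"
      by (simp add: xy m_assoc)
    also have "p [^] k \<otimes> p [^] (k choose 2) = p [^] (Suc k choose 2)"
      by (simp only: c2 nat_pow_mult assms)
    also have "p [^] (Suc k choose 2) \<otimes> (z [^] k \<otimes> z) = z [^] Suc k \<otimes> p [^] (Suc k choose 2)"
      using central_nat_pow[OF _ p, of "z [^] k \<otimes> z"] by simp
    also have "x \<otimes> x [^] k = x [^] Suc k" by (simp only: nat_pow_Suc2 assms)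
    finally show ?case .
  qed (simp add: numeral_2_eq_2)
  show ?B
  proof (induction k)
    case (Suc k)
    have "x \<otimes> y [^] Suc k = (x \<otimes> y [^] k) \<otimes> y" by (simp add: m_assoc)
    also have "\<dots> = z [^] k \<otimes> q [^] (k choose 2) \<otimes> y [^] k \<otimes> (x \<otimes> y)"
      by (simp add: Suc m_assoc)
    also have "\<dots> = z [^] k \<otimes> q [^] (k choose 2) \<otimes> (y [^] k \<otimes> z) \<otimes> y \<otimes> x"
      by (simp add: xy m_assoc)
    also have "\<dots> = z [^] k \<otimes> (q [^] (k choose 2) \<otimes> q [^] k \<otimes> z) \<otimes> (y [^] k \<otimes> y) \<otimes> x"
      by (simp add: zy m_assoc)
    also have "q [^] (k choose 2) \<otimes> q [^] k = q [^] (Suc k choose 2)"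
      by (simp add: c2 nat_pow_mult add.commute)
    also have "q [^] (Suc k choose 2) \<otimes> z = z \<otimes> q [^] (Suc k choose 2)"
      using central_nat_pow[OF _ q, of z] by simp
    finally show ?case by (simp add: m_assoc)
  qed (simp add: numeral_2_eq_2)
qed

text \<open>As x^m commutes with y and y^m with x, the two expansions of \<open>class3_pow\<close>
  compute the inverse of z^m twice, once through p and once through q. This is the origin of the
  extra relation for even m.\<close>

lemma class3_torsion:
  assumes [simp]: "x \<in> carrier G" "y \<in> carrier G" "z \<in> carrier G" "p \<in> carrier G" "q \<in> carrier G"
    and rels: "x \<otimes> y = z \<otimes> y \<otimes> x" "x \<otimes> z = p \<otimes> z \<otimes> x" "y \<otimes> z = q \<otimes> z \<otimes> y"
    and central: "\<And>g. g \<in> carrier G \<Longrightarrow> p \<otimes> g = g \<otimes> p" "\<And>g. g \<in> carrier G \<Longrightarrow> q \<otimes> g = g \<otimes> q"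
    and xm: "x [^] (m::nat) \<otimes> y = y \<otimes> x [^] m" and ym: "x \<otimes> y [^] m = y [^] m \<otimes> x"
  shows "p [^] (m choose 2) = q [^] (m choose 2)"
proof -
  note a = class3_pow[OF assms(1-10), of m]
  have "z [^] m \<otimes> p [^] (m choose 2) \<otimes> (y \<otimes> x [^] m) = \<one> \<otimes> (y \<otimes> x [^] m)"
    using a(1) by (simp add: xm m_assoc)
  then have "z [^] m \<otimes> p [^] (m choose 2) = \<one>"
    by (subst (asm) right_cancel) simp_all
  moreover have "z [^] m \<otimes> q [^] (m choose 2) \<otimes> (y [^] m \<otimes> x) = \<one> \<otimes> (y [^] m \<otimes> x)"
    using a(2) by (simp add: ym m_assoc)
  then have "z [^] m \<otimes> q [^] (m choose 2) = \<one>"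
    by (subst (asm) right_cancel) simp_all
  ultimately show ?thesis
    by (metis assms(3-5) l_cancel nat_pow_closed)
qed

end

section \<open>Groups satisfying the Steinberg relations\<close>

locale steinberg = group G for G (structure) +
  fixes E :: "nat \<Rightarrow> nat \<Rightarrow> 'a" and n :: nat
  assumes E_closed: "i < j \<Longrightarrow> j < n \<Longrightarrow> E i j \<in> carrier G"
    and E_comm: "i < j \<Longrightarrow> j < n \<Longrightarrow> k < l \<Longrightarrow> l < n \<Longrightarrow> j \<noteq> k \<Longrightarrow> i \<noteq> l \<Longrightarrow>
      E i j \<otimes> E k l = E k l \<otimes> E i j"
    and E_rel: "i < j \<Longrightarrow> j < k \<Longrightarrow> k < n \<Longrightarrow> E i j \<otimes> E j k = E i k \<otimes> E j k \<otimes> E i j"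
begin

text \<open>Image of the matrix that differs from the identity only in column k, with entries v 0,
  ..., v (r-1) there. The factors commute, so they add like vectors.\<close>

primrec pcol :: "nat \<Rightarrow> (nat \<Rightarrow> int) \<Rightarrow> nat \<Rightarrow> 'a" where
  "pcol k v 0 = \<one>"
| "pcol k v (Suc r) = pcol k v r \<otimes> E r k [^] v r"

abbreviation col where "col k v \<equiv> pcol k v k"

lemma pcol_closed [simp]: "k < n \<Longrightarrow> r \<le> k \<Longrightarrow> pcol k v r \<in> carrier G"
  by (induction r) (auto simp: E_closed)

lemma pcol_cong: "(\<And>i. i < r \<Longrightarrow> v i = w i) \<Longrightarrow> pcol k v r = pcol k w r"
  by (induction r) auto

lemma commute_pow:
  assumes "x \<in> carrier G" "y \<in> carrier G" "x \<otimes> y = y \<otimes> x"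
  shows "x \<otimes> y [^] (t::int) = y [^] t \<otimes> x"
  using conj_int_pow[of x y y t] assms by simp

lemma pcol_commute:
  assumes "g \<in> carrier G" "k < n" "r \<le> k"
    and "\<And>i. i < r \<Longrightarrow> v i \<noteq> 0 \<Longrightarrow> g \<otimes> E i k = E i k \<otimes> g"
  shows "g \<otimes> pcol k v r = pcol k v r \<otimes> g"
  using assms
proof (induction r)
  case (Suc r)
  have [simp]: "E r k \<in> carrier G" using Suc by (simp add: E_closed)
  have "g \<otimes> E r k [^] v r = E r k [^] v r \<otimes> g"
    using Suc by (cases "v r = 0") (auto intro!: commute_pow)
  then show ?case using Suc
    by simp (metis \<open>E r k \<in> carrier G\<close> int_pow_closed m_assoc pcol_closed Suc_leD)
qed simp

lemma pcol_add:
  assumes "k < n" "r \<le> k"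
  shows "pcol k (\<lambda>i. v i + w i) r = pcol k v r \<otimes> pcol k w r"
  using assms
proof (induction r)
  case (Suc r)
  have [simp]: "E r k \<in> carrier G" "pcol k w r \<in> carrier G" "pcol k v r \<in> carrier G"
    using Suc by (simp_all add: E_closed)
  have "E r k \<otimes> pcol k w r = pcol k w r \<otimes> E r k"
    using Suc by (intro pcol_commute) (auto intro!: E_comm)
  then have *: "pcol k w r \<otimes> E r k [^] v r = E r k [^] v r \<otimes> pcol k w r"
    by (intro commute_pow) simp_all
  have "pcol k (\<lambda>i. v i + w i) (Suc r) = pcol k v r \<otimes> (pcol k w r \<otimes> E r k [^] v r) \<otimes> E r k [^] w r"
    using Suc by (simp add: int_pow_mult m_assoc)
  then show ?case by (simp only: *) (simp add: m_assoc)
qed simp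

lemma pcol_single:
  "k < n \<Longrightarrow> r \<le> k \<Longrightarrow> pcol k (\<lambda>i. if i = l then t else 0) r = (if l < r then E l k [^] t else \<one>)"
  by (induction r) (auto simp: E_closed less_Suc_eq)

text \<open>This is a row operation: a times row j is added to row i. The factor
  \<open>E j k\<close> is the only one in column k that need not commute with \<open>E i j\<close>,
  and it contributes the power of \<open>E i k\<close>.\<close>

lemma E_col:
  assumes "i < j" "j < k" "k < n"
  shows "E i j [^] a \<otimes> col k v = col k (\<lambda>l. v l + (if l = i then a * v j else 0)) \<otimes> E i j [^] a"
proof -
  have [simp]: "E i j \<in> carrier G" "E j k \<in> carrier G" "E i k \<in> carrier G"
    using assms by (simp_all add: E_closed)
  let ?v = "v(j := 0)"
  have split: "col k (\<lambda>l. v l + (if l = i then s else 0)) = col k ?v \<otimes> E i k [^] s \<otimes> E j k [^] v j" for s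
  proof -
    have "(\<lambda>l. v l + (if l = i then s else 0))
        = (\<lambda>l. (?v l + (if l = i then s else 0)) + (if l = j then v j else 0))"
      using assms by auto
    then show ?thesis using assms
      by (simp only:) (subst pcol_add, simp, simp, subst pcol_add, simp_all add: pcol_single)
  qed
  have v: "col k v = col k ?v \<otimes> E j k [^] v j"
    using split[of 0] assms by simp
  have "E i j \<otimes> col k ?v = col k ?v \<otimes> E i j"
    using assms by (intro pcol_commute) (auto intro!: E_comm)
  then have 1: "E i j [^] a \<otimes> col k ?v = col k ?v \<otimes> E i j [^] a"
    using commute_pow[of "col k ?v" "E i j" a] assms by simp
  have 2: "E i j [^] a \<otimes> E j k [^] v j = E i k [^] (a * v j) \<otimes> E j k [^] v j \<otimes> E i j [^] a"
    by (rule commutator_int_pow) (use assms in \<open>auto intro!: E_rel E_comm\<close>)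
  have "E i j [^] a \<otimes> col k v = (E i j [^] a \<otimes> col k ?v) \<otimes> E j k [^] v j"
    using assms by (simp add: v m_assoc)
  also have "\<dots> = col k ?v \<otimes> (E i j [^] a \<otimes> E j k [^] v j)"
    using assms by (simp add: 1 m_assoc)
  also have "\<dots> = col k (\<lambda>l. v l + (if l = i then a * v j else 0)) \<otimes> E i j [^] a"
    using assms by (simp add: 2 split m_assoc)
  finally show ?thesis .
qed

lemma pcol_col:
  assumes "j < k" "k < n" "r \<le> j"
  shows "pcol j a r \<otimes> col k v = col k (\<lambda>l. v l + (if l < r then a l * v j else 0)) \<otimes> pcol j a r"
  using assms(3)
proof (induction r arbitrary: v)
  case (Suc r)
  have [simp]: "E r j \<in> carrier G" "pcol j a r \<in> carrier G" "col k z \<in> carrier G" for z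
    using assms Suc.prems by (simp_all add: E_closed)
  let ?w = "\<lambda>l. v l + (if l = r then a r * v j else 0)"
  have "pcol j a (Suc r) \<otimes> col k v = pcol j a r \<otimes> (E r j [^] a r \<otimes> col k v)"
    by (simp add: m_assoc)
  also have "E r j [^] a r \<otimes> col k v = col k ?w \<otimes> E r j [^] a r"
    using assms Suc by (intro E_col) auto
  also have "pcol j a r \<otimes> (col k ?w \<otimes> E r j [^] a r) = pcol j a r \<otimes> col k ?w \<otimes> E r j [^] a r"
    by (simp add: m_assoc)
  also have "pcol j a r \<otimes> col k ?w
      = col k (\<lambda>l. ?w l + (if l < r then a l * ?w j else 0)) \<otimes> pcol j a r"
    using Suc by auto
  also have "(\<lambda>l. ?w l + (if l < r then a l * ?w j else 0)) = (\<lambda>l. v l + (if l < Suc r then a l * v j else 0))"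
  proof
    fix l
    show "?w l + (if l < r then a l * ?w j else 0) = v l + (if l < Suc r then a l * v j else 0)"
      using Suc.prems by (cases l r rule: linorder_cases) simp_all
  qed
  finally show ?case by (simp add: m_assoc)
qed (use assms in simp)

text \<open>A unitriangular integer matrix is the product of its columns, the last column first:
  $(I + v e_j^T)(I + w e_k^T) = I + v e_j^T + w e_k^T$ for $w$ supported above row $k \le j$.\<close>

primrec mat_word :: "nat \<Rightarrow> (nat \<Rightarrow> nat \<Rightarrow> int) \<Rightarrow> 'a" where
  "mat_word 0 A = \<one>"
| "mat_word (Suc k) A = col k (\<lambda>i. A i k) \<otimes> mat_word k A"

lemma mat_word_closed [simp]: "r \<le> n \<Longrightarrow> mat_word r A \<in> carrier G"
  by (induction r) auto

lemma mat_word_cong: "(\<And>i k. i < k \<Longrightarrow> k < r \<Longrightarrow> A i k = B i k) \<Longrightarrow> mat_word r A = mat_word r B"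
  by (induction r) (auto intro!: arg_cong2[of _ _ _ _ "(\<otimes>)"] pcol_cong)

lemma mat_word_col:
  assumes "r \<le> k" "k < n"
  shows "mat_word r A \<otimes> col k v = col k (\<lambda>l. v l + (\<Sum>j\<in>{l<..<r}. A l j * v j)) \<otimes> mat_word r A"
  using assms(1)
proof (induction r)
  case (Suc r)
  let ?w = "\<lambda>l. v l + (\<Sum>j\<in>{l<..<r}. A l j * v j)"
  have "mat_word (Suc r) A \<otimes> col k v = col r (\<lambda>i. A i r) \<otimes> (mat_word r A \<otimes> col k v)"
    using assms Suc by (simp add: m_assoc)
  also have "\<dots> = (col r (\<lambda>i. A i r) \<otimes> col k ?w) \<otimes> mat_word r A"
    using assms Suc by (simp add: m_assoc)
  also have "col r (\<lambda>i. A i r) \<otimes> col k ?w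
      = col k (\<lambda>l. ?w l + (if l < r then A l r * ?w r else 0)) \<otimes> col r (\<lambda>i. A i r)"
    using assms Suc by (intro pcol_col) auto
  also have "(\<lambda>l. ?w l + (if l < r then A l r * ?w r else 0))
      = (\<lambda>l. v l + (\<Sum>j\<in>{l<..<Suc r}. A l j * v j))"
  proof
    fix l
    have "{l<..<Suc r} = (if l < r then insert r {l<..<r} else {})" by auto
    then show "?w l + (if l < r then A l r * ?w r else 0) = v l + (\<Sum>j\<in>{l<..<Suc r}. A l j * v j)"
      by auto
  qed
  finally show ?case using assms Suc by (simp add: m_assoc)
qed (use assms in simp)

text \<open>In strictly upper entries this is the product (I+A)(I+B), so \<open>mat_word n\<close>
  is a homomorphism from UT_n(Z). Diagonal entries are never read.\<close>

lemma mat_word_mult: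
  assumes "r \<le> n"
  shows "mat_word r A \<otimes> mat_word r B
    = mat_word r (\<lambda>i k. A i k + B i k + (\<Sum>j\<in>{i<..<k}. A i j * B j k))"
  using assms
proof (induction r)
  case (Suc r)
  let ?w = "\<lambda>l. B l r + (\<Sum>j\<in>{l<..<r}. A l j * B j r)"
  have "mat_word (Suc r) A \<otimes> mat_word (Suc r) B
      = col r (\<lambda>i. A i r) \<otimes> (mat_word r A \<otimes> col r (\<lambda>i. B i r)) \<otimes> mat_word r B"
    using Suc by (simp add: m_assoc)
  also have "\<dots> = (col r (\<lambda>i. A i r) \<otimes> col r ?w) \<otimes> (mat_word r A \<otimes> mat_word r B)"
    using Suc by (simp add: mat_word_col m_assoc)
  finally show ?case using Suc by (simp add: pcol_add[symmetric] add.assoc)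
qed simp

end

text \<open>The additive map \<open>\<iota>\<close> names central elements; the matrix word then depends on the
  entries modulo \<open>m\<close> up to the central elements attached to the superdiagonal.\<close>

locale steinberg_mod = steinberg G E n for G (structure) and E n +
  fixes m :: int and \<iota> :: "'m :: comm_ring_1 \<Rightarrow> 'a" and w :: "nat \<Rightarrow> 'm"
  assumes iota_closed [simp]: "\<iota> x \<in> carrier G"
    and iota_add: "\<iota> (x + y) = \<iota> x \<otimes> \<iota> y"
    and iota_central: "g \<in> carrier G \<Longrightarrow> \<iota> x \<otimes> g = g \<otimes> \<iota> x"
    and E_pow: "Suc i < j \<Longrightarrow> j < n \<Longrightarrow> E i j [^] m = \<one>"
    and E_pow_simple: "Suc i < n \<Longrightarrow> E i (Suc i) [^] m = \<iota> (w i)"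
begin

lemma iota_zero: "\<iota> 0 = \<one>"
proof -
  have "\<iota> 0 \<otimes> \<iota> 0 = \<iota> 0 \<otimes> \<one>" using iota_add[of 0 0] by simp
  then show ?thesis by (metis iota_closed l_cancel one_closed)
qed

lemma iota_pow: "\<iota> x [^] (t::int) = \<iota> (of_int t * x)"
proof -
  have nat: "\<iota> x [^] k = \<iota> (of_nat k * x)" for k :: nat
    by (induction k) (simp_all add: iota_zero distrib_right iota_add[symmetric] add.commute)
  show ?thesis
  proof (cases t)
    case (neg k)
    have "\<iota> (- (of_nat (Suc k) * x)) \<otimes> \<iota> (of_nat (Suc k) * x) = \<one>"
      by (simp only: iota_add[symmetric] add.left_inverse iota_zero)
    then have "inv (\<iota> (of_nat (Suc k) * x)) = \<iota> (- (of_nat (Suc k) * x))"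
      by (simp add: inv_equality del: of_nat_Suc)
    moreover have "\<iota> x [^] (- int (Suc k)) = inv (\<iota> (of_nat (Suc k) * x))"
      by (simp only: int_pow_neg_int iota_closed nat)
    ultimately show ?thesis unfolding neg by (simp del: of_nat_Suc)
  qed (simp add: int_pow_int nat)
qed

text \<open>Row k - 1 is the superdiagonal position of column k. All other m-th powers are
  trivial.\<close>

lemma pcol_mult_m:
  "k < n \<Longrightarrow> r \<le> k \<Longrightarrow> pcol k (\<lambda>i. m * q i) r
    = (if r = k \<and> 0 < k then \<iota> (of_int (q (k - 1)) * w (k - 1)) else \<one>)"
proof (induction r)
  case (Suc r)
  have [simp]: "E r k \<in> carrier G" using Suc by (simp add: E_closed)
  have "E r k [^] (m * q r) = (E r k [^] m) [^] q r" by (simp add: int_pow_pow)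
  then show ?case using Suc
    by (cases "Suc r = k") (auto simp: E_pow E_pow_simple iota_pow)
qed auto

lemma mat_word_add_mult_m:
  "r \<le> n \<Longrightarrow> mat_word r (\<lambda>i k. A i k + m * Q i k)
    = mat_word r A \<otimes> \<iota> (\<Sum>k<r - 1. of_int (Q k (Suc k)) * w k)"
proof (induction r)
  case (Suc r)
  let ?S = "\<lambda>r. (\<Sum>k<r - 1. of_int (Q k (Suc k)) * w k)"
  have c: "col r (\<lambda>i. m * Q i r) = \<iota> (?S (Suc r) - ?S r)"
  \<comment> \<open>Column 0 is empty. Truncated subtraction makes both sums empty there, so column
    1 is the first to contribute.\<close>
  proof (cases "r = 0")
    case False
    then obtain s where s: "r = Suc s" by (cases r) auto
    have "col r (\<lambda>i. m * Q i r) = \<iota> (of_int (Q (r - 1) r) * w (r - 1))"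
      by (subst pcol_mult_m) (use Suc.prems False in auto)
    also have "of_int (Q (r - 1) r) * w (r - 1) = ?S (Suc r) - ?S r"
      unfolding s by simp
    finally show ?thesis .
  qed (simp add: iota_zero)
  have "mat_word (Suc r) (\<lambda>i k. A i k + m * Q i k)
      = col r (\<lambda>i. A i r) \<otimes> \<iota> (?S (Suc r) - ?S r) \<otimes> (mat_word r A \<otimes> \<iota> (?S r))"
    using Suc by (simp add: pcol_add c)
  also have "\<dots> = col r (\<lambda>i. A i r) \<otimes> (\<iota> (?S (Suc r) - ?S r) \<otimes> mat_word r A) \<otimes> \<iota> (?S r)"
    using Suc by (simp add: m_assoc)
  also have "\<dots> = mat_word (Suc r) A \<otimes> (\<iota> (?S (Suc r) - ?S r) \<otimes> \<iota> (?S r))"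
    using Suc by (simp add: iota_central[of "mat_word r A"] m_assoc)
  also have "\<iota> (?S (Suc r) - ?S r) \<otimes> \<iota> (?S r) = \<iota> (?S (Suc r))"
    by (simp only: iota_add[symmetric] diff_add_cancel)
  finally show ?case .
qed (simp add: iota_zero)

end

section \<open>Unitriangular matrices modulo \<open>m\<close>\<close>

locale unitriangular =
  fixes n :: nat and m :: int
  assumes m_ge_2: "m \<ge> 2"
begin

abbreviation U where "U \<equiv> UT n m"

lemma one_mod_m [simp]: "1 mod m = 1"
  using m_ge_2 by simp

lemma UT_one: "\<one>\<^bsub>U\<^esub> i j = (if i < n \<and> i = j then 1 else 0)"
  by (simp add: UT_def)

lemma UT_mult: "(A \<otimes>\<^bsub>U\<^esub> B) i j = (if i < n \<and> j < n then (\<Sum>k<n. A i k * B k j) mod m else 0)"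
  by (simp add: UT_def)

lemma UT_carrier_iff: "A \<in> carrier U \<longleftrightarrow>
    (\<forall>i j. (i < j \<and> j < n \<longrightarrow> 0 \<le> A i j \<and> A i j < m) \<and> (i < n \<longrightarrow> A i i = 1)
       \<and> (j < i \<or> n \<le> i \<or> n \<le> j \<longrightarrow> A i j = 0))" (is "?L \<longleftrightarrow> ?R")
proof
  assume ?L
  then have *: "A i j \<in> (if i < n \<and> j < n then (if i < j then {0..<m} else if i = j then {1} else {0})
      else {0})" for i j
    by (auto simp: UT_def)
  show ?R
  proof (intro allI)
    fix i j
    show "(i < j \<and> j < n \<longrightarrow> 0 \<le> A i j \<and> A i j < m) \<and> (i < n \<longrightarrow> A i i = 1)
       \<and> (j < i \<or> n \<le> i \<or> n \<le> j \<longrightarrow> A i j = 0)"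
      using *[of i j] *[of i i] by (auto split: if_splits)
  qed
next
  assume ?R
  then show ?L by (auto simp: UT_def)
qed

lemma UT_entry_range: "A \<in> carrier U \<Longrightarrow> 0 \<le> A i j \<and> A i j < m"
  using m_ge_2 unfolding UT_carrier_iff
  by (cases i j rule: linorder_cases) (metis leI less_le_trans zero_less_one zero_less_numeral
      order_refl less_eq_nat.simps(1) one_less_numeral_iff semiring_norm(76) less_trans zero_le_one)+

lemma UT_diag: "A \<in> carrier U \<Longrightarrow> i < n \<Longrightarrow> A i i = 1"
  and UT_lower: "A \<in> carrier U \<Longrightarrow> j < i \<Longrightarrow> A i j = 0"
  and UT_outside: "A \<in> carrier U \<Longrightarrow> n \<le> i \<or> n \<le> j \<Longrightarrow> A i j = 0"
  unfolding UT_carrier_iff by blast+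

lemma UT_sum:
  assumes "A \<in> carrier U" "B \<in> carrier U" "j < n"
  shows "(\<Sum>k<n. A i k * B k j) = (\<Sum>k=i..j. A i k * B k j)"
proof (rule sum.mono_neutral_right)
  show "\<forall>k\<in>{..<n} - {i..j}. A i k * B k j = 0"
    using assms by (auto simp: UT_lower not_le)
qed (use assms in auto)

lemma UT_mult_entry:
  assumes AB: "A \<in> carrier U" "B \<in> carrier U" and ij: "i < j" "j < n"
  shows "(A \<otimes>\<^bsub>U\<^esub> B) i j = (A i j + B i j + (\<Sum>k\<in>{i<..<j}. A i k * B k j)) mod m"
proof -
  have "{i..j} = insert i (insert j {i<..<j})" using ij by auto
  then show ?thesis
    using assms by (simp add: UT_mult UT_sum UT_diag add_ac)
qed

lemma UT_mult_closed:
  assumes "A \<in> carrier U" "B \<in> carrier U"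
  shows "A \<otimes>\<^bsub>U\<^esub> B \<in> carrier U"
  unfolding UT_carrier_iff using assms m_ge_2
  by (auto simp: UT_mult UT_sum UT_diag)

lemma UT_one_closed: "\<one>\<^bsub>U\<^esub> \<in> carrier U"
  using m_ge_2 by (auto simp: UT_carrier_iff UT_one)

lemma UT_eqI:
  assumes "A \<in> carrier U" "B \<in> carrier U" "\<And>i j. i < j \<Longrightarrow> j < n \<Longrightarrow> A i j = B i j"
  shows "A = B"
proof (intro ext)
  fix i j
  show "A i j = B i j"
    using assms by (cases i j rule: linorder_cases; cases "i < n"; cases "j < n")
      (auto simp: UT_diag UT_lower UT_outside)
qed

lemma UT_assoc: "A \<otimes>\<^bsub>U\<^esub> B \<otimes>\<^bsub>U\<^esub> C = A \<otimes>\<^bsub>U\<^esub> (B \<otimes>\<^bsub>U\<^esub> C)"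
proof (intro ext)
  fix i j
  show "(A \<otimes>\<^bsub>U\<^esub> B \<otimes>\<^bsub>U\<^esub> C) i j = (A \<otimes>\<^bsub>U\<^esub> (B \<otimes>\<^bsub>U\<^esub> C)) i j"
  proof (cases "i < n \<and> j < n")
    case True
    have "(A \<otimes>\<^bsub>U\<^esub> B \<otimes>\<^bsub>U\<^esub> C) i j = (\<Sum>l<n. ((\<Sum>k<n. A i k * B k l) mod m * C l j) mod m) mod m"
      using True by (simp add: UT_mult mod_sum_eq)
    also have "\<dots> = (\<Sum>l<n. (\<Sum>k<n. A i k * B k l) * C l j) mod m"
      by (simp add: mod_mult_left_eq mod_sum_eq)
    also have "(\<Sum>l<n. (\<Sum>k<n. A i k * B k l) * C l j) = (\<Sum>k<n. A i k * (\<Sum>l<n. B k l * C l j))"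
      unfolding sum_distrib_left sum_distrib_right by (subst sum.swap) (simp add: mult.assoc)
    also have "\<dots> mod m = (\<Sum>k<n. (A i k * ((\<Sum>l<n. B k l * C l j) mod m)) mod m) mod m"
      by (simp add: mod_mult_right_eq mod_sum_eq)
    also have "\<dots> = (A \<otimes>\<^bsub>U\<^esub> (B \<otimes>\<^bsub>U\<^esub> C)) i j"
      using True by (simp add: UT_mult mod_sum_eq)
    finally show ?thesis .
  qed (auto simp: UT_mult)
qed

text \<open>Row i of the left inverse, solved from left to right: entry j depends only on entries in
  earlier columns.\<close>

function linv :: "(nat \<Rightarrow> nat \<Rightarrow> int) \<Rightarrow> nat \<Rightarrow> nat \<Rightarrow> int" where
  "linv A i j = (if i < n \<and> j < n then (if i < j then (- (\<Sum>k\<in>{i..<j}. linv A i k * A k j)) mod m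
     else if i = j then 1 else 0) else 0)"
  by auto
termination by (relation "measure (\<lambda>(A, i, j). j)") auto

declare linv.simps [simp del]

lemma linv_closed: "linv A \<in> carrier U"
  using m_ge_2 unfolding UT_carrier_iff by (auto simp: linv.simps[of A])

lemma linv_mult: assumes A: "A \<in> carrier U" shows "linv A \<otimes>\<^bsub>U\<^esub> A = \<one>\<^bsub>U\<^esub>"
proof (rule UT_eqI[OF UT_mult_closed[OF linv_closed A] UT_one_closed])
  fix i j :: nat assume ij: "i < j" "j < n"
  have "{i..j} = insert j {i..<j}" using ij by auto
  then have "(linv A \<otimes>\<^bsub>U\<^esub> A) i j = (linv A i j + (\<Sum>k\<in>{i..<j}. linv A i k * A k j)) mod m"
    using ij A by (simp add: UT_mult UT_sum linv_closed UT_diag)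
  also have "linv A i j = (- (\<Sum>k\<in>{i..<j}. linv A i k * A k j)) mod m"
    using ij by (simp add: linv.simps[of A i j])
  also have "(\<dots> + (\<Sum>k\<in>{i..<j}. linv A i k * A k j)) mod m = 0"
    by (simp add: mod_add_left_eq)
  finally show "(linv A \<otimes>\<^bsub>U\<^esub> A) i j = \<one>\<^bsub>U\<^esub> i j"
    using ij by (simp add: UT_one)
qed

lemma group_UT: "group U"
proof (rule groupI)
  fix A assume A: "A \<in> carrier U"
  show "\<one>\<^bsub>U\<^esub> \<otimes>\<^bsub>U\<^esub> A = A"
  proof (rule UT_eqI[OF UT_mult_closed[OF UT_one_closed A] A])
    fix i j :: nat assume "i < j" "j < n"
    then show "(\<one>\<^bsub>U\<^esub> \<otimes>\<^bsub>U\<^esub> A) i j = A i j"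
      using A UT_entry_range[OF A, of i j] by (simp add: UT_mult_entry UT_one_closed UT_one)
  qed
  show "\<exists>B\<in>carrier U. B \<otimes>\<^bsub>U\<^esub> A = \<one>\<^bsub>U\<^esub>"
    using linv_closed linv_mult[OF A] by blast
qed (simp_all add: UT_mult_closed UT_one_closed UT_assoc)

lemma finite_UT: "finite (carrier U)"
proof (rule finite_subset)
  let ?R = "{f. (\<forall>j. (j \<in> {..<n} \<longrightarrow> f j \<in> {0..<m}) \<and> (j \<notin> {..<n} \<longrightarrow> f j = 0))}"
  show "carrier U \<subseteq> {A. \<forall>i. (i \<in> {..<n} \<longrightarrow> A i \<in> ?R) \<and> (i \<notin> {..<n} \<longrightarrow> A i = (\<lambda>_. 0))}"
    by (auto simp: UT_entry_range UT_outside)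
  show "finite \<dots>"
    by (intro finite_set_of_finite_funs) auto
qed

definition el :: "nat \<Rightarrow> nat \<Rightarrow> int \<Rightarrow> nat \<Rightarrow> nat \<Rightarrow> int" where
  "el i j t = (\<lambda>r c. if r < n \<and> c < n then (if r = c then 1 else if r = i \<and> c = j then t mod m else 0)
     else 0)"

abbreviation e where "e i j \<equiv> el i j 1"

lemma el_closed [simp]: "i < j \<Longrightarrow> el i j t \<in> carrier U"
  using m_ge_2 by (auto simp: UT_carrier_iff el_def)

lemma mult_el:
  assumes A: "A \<in> carrier U" and ij: "i < j" "j < n" and rc: "r < n" "c < n"
  shows "(A \<otimes>\<^bsub>U\<^esub> el i j t) r c = (A r c + (if c = j then A r i * t else 0)) mod m"
proof -
  have "(A \<otimes>\<^bsub>U\<^esub> el i j t) r c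
      = (\<Sum>k<n. (if k = c then A r c else 0) + (if k = i \<and> c = j then A r i * (t mod m) else 0)) mod m"
    unfolding UT_mult using ij rc by (intro if_P[THEN trans] arg_cong2[of _ _ _ _ "(mod)"] sum.cong)
      (auto simp: el_def)
  also have "\<dots> = (A r c + (if c = j then A r i * (t mod m) else 0)) mod m"
    using ij rc by (simp add: sum.distrib)
  also have "\<dots> = (A r c + (if c = j then A r i * t else 0)) mod m"
    by (simp, metis mod_add_right_eq mod_mult_right_eq)
  finally show ?thesis .
qed

lemma el_add: assumes "i < j" "j < n" shows "el i j s \<otimes>\<^bsub>U\<^esub> el i j t = el i j (s + t)"
  using assms by (intro UT_eqI UT_mult_closed)
    (auto simp: mult_el, auto simp: el_def mod_simps)

lemma el_zero: "el i j 0 = \<one>\<^bsub>U\<^esub>"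
  by (auto simp: el_def UT_one fun_eq_iff)

lemma el_m: "el i j m = \<one>\<^bsub>U\<^esub>"
  by (auto simp: el_def UT_one fun_eq_iff)

lemma e_comm:
  assumes "i < j" "j < n" "k < l" "l < n" "j \<noteq> k" "i \<noteq> l"
  shows "e i j \<otimes>\<^bsub>U\<^esub> e k l = e k l \<otimes>\<^bsub>U\<^esub> e i j"
  using assms by (intro UT_eqI UT_mult_closed)
    (auto simp: mult_el, auto simp: el_def)

lemma e_rel:
  assumes "i < j" "j < k" "k < n"
  shows "e i j \<otimes>\<^bsub>U\<^esub> e j k = e i k \<otimes>\<^bsub>U\<^esub> e j k \<otimes>\<^bsub>U\<^esub> e i j"
  using assms by (intro UT_eqI UT_mult_closed)
    (auto simp: mult_el UT_mult_closed, auto simp: el_def)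

lemma el_nat_pow: assumes "i < j" "j < n" shows "e i j [^]\<^bsub>U\<^esub> (k::nat) = el i j (int k)"
  using assms by (induction k) (auto simp: el_zero el_add add.commute)

end

section \<open>The central copy of the coefficients in the extension\<close>

context cocycle_mod
begin

text \<open>The shift by \<open>u \<one> \<one>\<close> makes this a homomorphism although the
  cocycle is not normalized.\<close>

definition iota where "iota x = lift (x - u \<one> \<one>) \<one>"

lemma iota_closed [simp]: "iota x \<in> carrier ext_group"
  by (simp add: iota_def)

lemma iota_add: "iota (x + y) = iota x \<otimes>\<^bsub>ext_group\<^esub> iota y"
  by (simp add: iota_def lift_mult lift_eq_iff H_zero)

lemma iota_central: "e \<in> carrier ext_group \<Longrightarrow> iota x \<otimes>\<^bsub>ext_group\<^esub> e = e \<otimes>\<^bsub>ext_group\<^esub> iota x"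
  unfolding iota_def by (rule lift_one_central)

lemma iota_mult_lift:
  "g \<in> carrier G \<Longrightarrow> iota x \<otimes>\<^bsub>ext_group\<^esub> lift y g = lift (x + y) g"
  using u_one[of g] by (simp add: iota_def lift_mult lift_eq_iff algebra_simps)

lemma iota_nat_pow: "iota x [^]\<^bsub>ext_group\<^esub> k = iota (of_nat k * x)"
proof (induction k)
  case 0
  then show ?case by (simp add: iota_def ext_one)
next
  case (Suc k)
  then show ?case by (simp add: iota_add[symmetric] distrib_right add.commute)
qed

lemma lift_one_eq_iota: "lift x \<one> = iota (x + u \<one> \<one>)"
  by (simp add: iota_def)

lemma lift_commutator:
  assumes "g \<in> carrier G" "h \<in> carrier G" "g \<otimes> h = h \<otimes> g"
  shows "lift x g \<otimes>\<^bsub>ext_group\<^esub> lift y h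
    = iota (tau g h) \<otimes>\<^bsub>ext_group\<^esub> lift y h \<otimes>\<^bsub>ext_group\<^esub> lift x g"
  using assms by (simp add: iota_mult_lift) (simp add: lift_mult lift_eq_iff tau_def H_zero)

text \<open>The power projects to the identity, and the kernel of \<open>snd\<close> is
  central.\<close>

lemma nat_pow_central:
  assumes x: "x \<in> carrier ext_group" and 1: "snd x [^] (k::nat) = \<one>" and y: "y \<in> carrier ext_group"
  shows "x [^]\<^bsub>ext_group\<^esub> k \<otimes>\<^bsub>ext_group\<^esub> y = y \<otimes>\<^bsub>ext_group\<^esub> x [^]\<^bsub>ext_group\<^esub> k"
proof -
  interpret E: group ext_group by (rule group_ext_group)
  have "snd (x [^]\<^bsub>ext_group\<^esub> k) = \<one>"
    using group_hom.hom_nat_pow[OF snd_hom x] 1 by simp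
  moreover have "x [^]\<^bsub>ext_group\<^esub> k \<in> carrier ext_group"
    using x by simp
  ultimately obtain z where "x [^]\<^bsub>ext_group\<^esub> k = lift z \<one>"
    by (metis carrier_ext_groupE snd_lift)
  then show ?thesis using lift_one_central[OF y] by simp
qed

end

section \<open>Commutator relations in central extensions of unitriangular groups\<close>

locale unitriangular_cocycle = unitriangular n m + cocycle_mod "UT n m" u H
  for n :: nat and m :: int and u :: "(nat \<Rightarrow> nat \<Rightarrow> int) \<Rightarrow> (nat \<Rightarrow> nat \<Rightarrow> int) \<Rightarrow> 'm :: comm_ring_1"
    and H :: "'m set"
begin

sublocale ext: group ext_group by (rule group_ext_group)

lemma e_torsion: "i < j \<Longrightarrow> j < n \<Longrightarrow> e i j [^]\<^bsub>U\<^esub> nat m = \<one>\<^bsub>U\<^esub>"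
  using m_ge_2 by (subst el_nat_pow) (simp_all add: el_m)

lemma e_tau_torsion:
  assumes "i < j" "j < n" "k < l" "l < n" "j \<noteq> k" "i \<noteq> l"
  shows "of_nat (nat m) * tau (e i j) (e k l) \<in> H"
  using assms by (intro tau_torsion e_comm e_torsion) auto

text \<open>Lifts of two adjacent superdiagonal generators have central m-th powers, and their
  commutator has central commutators with both of them. This is the situation of
  \<open>class3_torsion\<close>.\<close>

lemma e_tau_heisenberg:
  assumes i: "i + 2 < n"
  shows "of_nat (nat m choose 2) * (tau (e i (i+1)) (e i (i+2)) - tau (e (i+1) (i+2)) (e i (i+2))) \<in> H"
proof -
  let ?g = "e i (i+1)" and ?h = "e (i+1) (i+2)" and ?k = "e i (i+2)"
  let ?x = "lift 0 ?g" and ?y = "lift 0 ?h"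
  \<comment> \<open>This coordinate makes \<open>?z\<close> exactly the commutator of
    \<open>?x\<close> and \<open>?y\<close> rather than some lift of \<open>?k\<close>.\<close>
  let ?z = "lift (u ?g ?h - u ?h ?g - u ?k (?h \<otimes>\<^bsub>U\<^esub> ?g)) ?k"
  have gh: "?g \<otimes>\<^bsub>U\<^esub> ?h = ?k \<otimes>\<^bsub>U\<^esub> (?h \<otimes>\<^bsub>U\<^esub> ?g)"
    using e_rel[of i "i+1" "i+2"] i by (simp add: m_assoc)
  have "iota (tau ?g ?k) [^]\<^bsub>ext_group\<^esub> (nat m choose 2) = iota (tau ?h ?k) [^]\<^bsub>ext_group\<^esub> (nat m choose 2)"
  proof (rule ext.class3_torsion[of ?x ?y ?z])
    have "?z \<otimes>\<^bsub>ext_group\<^esub> (?y \<otimes>\<^bsub>ext_group\<^esub> ?x) = ?x \<otimes>\<^bsub>ext_group\<^esub> ?y"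
      by (simp add: lift_mult lift_eq_iff gh[simplified] H_zero)
    then show "?x \<otimes>\<^bsub>ext_group\<^esub> ?y = ?z \<otimes>\<^bsub>ext_group\<^esub> ?y \<otimes>\<^bsub>ext_group\<^esub> ?x"
      by (simp add: ext.m_assoc)
    show "?x \<otimes>\<^bsub>ext_group\<^esub> ?z = iota (tau ?g ?k) \<otimes>\<^bsub>ext_group\<^esub> ?z \<otimes>\<^bsub>ext_group\<^esub> ?x"
      "?y \<otimes>\<^bsub>ext_group\<^esub> ?z = iota (tau ?h ?k) \<otimes>\<^bsub>ext_group\<^esub> ?z \<otimes>\<^bsub>ext_group\<^esub> ?y"
      by (rule lift_commutator; use i in \<open>simp add: e_comm\<close>)+
    show "?x [^]\<^bsub>ext_group\<^esub> nat m \<otimes>\<^bsub>ext_group\<^esub> ?y = ?y \<otimes>\<^bsub>ext_group\<^esub> ?x [^]\<^bsub>ext_group\<^esub> nat m"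
      "?x \<otimes>\<^bsub>ext_group\<^esub> ?y [^]\<^bsub>ext_group\<^esub> nat m = ?y [^]\<^bsub>ext_group\<^esub> nat m \<otimes>\<^bsub>ext_group\<^esub> ?x"
      using i by (simp_all add: nat_pow_central e_torsion)
  qed (simp_all add: iota_central)
  then show ?thesis
    unfolding iota_nat_pow unfolding iota_def by (simp add: lift_eq_iff right_diff_distrib)
qed

text \<open>An index r inside (k,l) avoiding i and j writes \<open>e k l\<close> as a commutator of
  two elements that both commute with \<open>e i j\<close>.\<close>

lemma e_tau_commutator:
  assumes "i < j" "j < n" "k < l" "l < n" "j \<noteq> k" "i \<noteq> l" "k < r" "r < l" "r \<noteq> i" "r \<noteq> j"
  shows "tau (e i j) (e k l) \<in> H"
  using assms by (intro tau_commutator[of _ "e k r" "e r l"] e_comm e_rel) auto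

lemma e_tau_crossing:
  assumes i: "i + 3 < n"
  shows "tau (e i (i+2)) (e (i+1) (i+3)) + tau (e i (i+3)) (e (i+1) (i+2)) \<in> H"
    and "tau (e i (i+2)) (e (i+1) (i+3)) + tau (e (i+1) (i+2)) (e i (i+3)) \<in> H"
proof -
  have conj: "e (i+2) (i+3) \<otimes>\<^bsub>U\<^esub> (e k (i+2) \<otimes>\<^bsub>U\<^esub> e k (i+3)) = e k (i+2) \<otimes>\<^bsub>U\<^esub> e (i+2) (i+3)"
    if "k < i+2" for k
  proof -
    have "e k (i+2) \<otimes>\<^bsub>U\<^esub> e k (i+3) = e k (i+3) \<otimes>\<^bsub>U\<^esub> e k (i+2)"
      using that i by (intro e_comm) auto
    moreover have "e (i+2) (i+3) \<otimes>\<^bsub>U\<^esub> e k (i+3) = e k (i+3) \<otimes>\<^bsub>U\<^esub> e (i+2) (i+3)"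
      using that i by (intro e_comm) auto
    ultimately show ?thesis
      using e_rel[of k "i+2" "i+3"] i that by (simp add: m_assoc[symmetric])
  qed
  have *: "tau (e i (i+3)) (e (i+1) (i+3)) \<in> H" "tau (e i (i+2)) (e i (i+3)) \<in> H"
    using e_tau_commutator[of "i+1" "i+3" i "i+3" "i+2"] e_tau_commutator[of i "i+2" i "i+3" "i+1"]
      H_uminus i tau_swap[of "e i (i+3)" "e (i+1) (i+3)"] by auto
  show "tau (e i (i+2)) (e (i+1) (i+3)) + tau (e i (i+3)) (e (i+1) (i+2)) \<in> H"
    using i by (intro tau_crossing(1)[of "e i (i+1)" "e (i+2) (i+3)"] conj e_comm * e_rel) auto
  show "tau (e i (i+2)) (e (i+1) (i+3)) + tau (e (i+1) (i+2)) (e i (i+3)) \<in> H"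
    using i by (intro tau_crossing(2)[of "e i (i+1)" "e (i+2) (i+3)"] conj e_comm * e_rel) auto
qed

text \<open>The nested pair enters the two crossing relations with opposite signs, so adding them
  leaves twice the crossing class.\<close>

lemma e_tau_two_torsion:
  assumes i: "i + 3 < n"
  shows "2 * tau (e i (i+2)) (e (i+1) (i+3)) \<in> H"
  using H_add[OF e_tau_crossing[OF i]] tau_swap[of "e i (i+3)" "e (i+1) (i+2)"]
  by (simp add: algebra_simps)

end

section \<open>Steinberg relations once the basic commutator classes vanish\<close>

locale unitriangular_tori = unitriangular_cocycle n m u H
  for n :: nat and m :: int and u :: "(nat \<Rightarrow> nat \<Rightarrow> int) \<Rightarrow> (nat \<Rightarrow> nat \<Rightarrow> int) \<Rightarrow> 'm :: comm_ring_1"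
    and H :: "'m set" +
  assumes tau_far: "Suc i < j \<Longrightarrow> Suc j < n \<Longrightarrow> tau (e i (Suc i)) (e j (Suc j)) \<in> H"
    and tau_left: "i + 2 < n \<Longrightarrow> tau (e i (i+2)) (e i (i+1)) \<in> H"
    and tau_right: "i + 2 < n \<Longrightarrow> tau (e i (i+2)) (e (i+1) (i+2)) \<in> H"
    and tau_cross: "i + 3 < n \<Longrightarrow> tau (e i (i+2)) (e (i+1) (i+3)) \<in> H"
begin

lemma tau_sym: "tau x y \<in> H \<Longrightarrow> tau y x \<in> H"
  using H_uminus[of "tau x y"] tau_swap[of x y] by simp

lemma tau_nested: "i + 3 < n \<Longrightarrow> tau (e i (i+3)) (e (i+1) (i+2)) \<in> H"
  using H_diff[OF e_tau_crossing(1) tau_cross, of i i] by simp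

text \<open>If an index strictly inside one interval is not an endpoint of the other,
  \<open>e_tau_commutator\<close> applies. Otherwise both intervals have length at most 3, and only
  equal pairs, nested pairs and the assumed classes remain.\<close>

lemma e_tau_trivial:
  assumes *: "i < j" "j < n" "k < l" "l < n" "j \<noteq> k" "i \<noteq> l"
  shows "tau (e i j) (e k l) \<in> H"
proof (cases "(\<exists>r. k < r \<and> r < l \<and> r \<noteq> i \<and> r \<noteq> j) \<or> (\<exists>r. i < r \<and> r < j \<and> r \<noteq> k \<and> r \<noteq> l)")
  case True
  then show ?thesis
    using e_tau_commutator[of i j k l] tau_sym[OF e_tau_commutator[of k l i j]] * by blast
next
  case False
  have a: "r = i \<or> r = j" if "k < r" "r < l" for r using False that by blast
  have b: "r = k \<or> r = l" if "i < r" "r < j" for r using False that by blast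
  have "i = k \<and> j = l \<or> (j = i+1 \<and> l = k+1 \<and> (i+1 < k \<or> k+1 < i))
    \<or> (j = i+2 \<and> l = k+1 \<and> (k = i \<or> k = i+1)) \<or> (l = k+2 \<and> j = i+1 \<and> (i = k \<or> i = k+1))
    \<or> (j = i+2 \<and> l = k+2 \<and> (k = i+1 \<or> i = k+1))
    \<or> (j = i+3 \<and> l = k+1 \<and> k = i+1) \<or> (l = k+3 \<and> j = i+1 \<and> i = k+1)"
  proof -
    have "l = k+1 \<or> l = k+2 \<or> l = k+3"
      using *(3) a[of "k+1"] a[of "k+2"] a[of "k+3"] by linarith
    moreover have "j = i+1 \<or> j = i+2 \<or> j = i+3"
      using *(1) b[of "i+1"] b[of "i+2"] b[of "i+3"] by linarith
    ultimately show ?thesis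
      using *(5,6) a[of "k+1"] a[of "k+2"] b[of "i+1"] b[of "i+2"]
      by (elim disjE) (simp; linarith)+
  qed
  then show ?thesis
    using * tau_far[of i k] tau_sym[OF tau_far[of k i]]
      tau_left[of i] tau_right[of i] tau_sym[OF tau_left[of k]] tau_sym[OF tau_right[of k]]
      tau_cross[of i] tau_sym[OF tau_cross[of k]] tau_nested[of i] tau_sym[OF tau_nested[of k]]
    by (elim disjE conjE) (auto simp: tau_def H_zero eval_nat_numeral)
qed

text \<open>Iterated commutators with the next superdiagonal lift, so that the Steinberg relation
  with a superdiagonal right factor holds by construction. Values with j \<le> i are
  placeholders.\<close>

primrec E :: "nat \<Rightarrow> nat \<Rightarrow> 'm \<times> (nat \<Rightarrow> nat \<Rightarrow> int)" where
  "E i 0 = lift 0 \<one>\<^bsub>U\<^esub>"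
| "E i (Suc j) = (if i = j then lift 0 (e i (Suc i))
     else E i j \<otimes>\<^bsub>ext_group\<^esub> lift 0 (e j (Suc j))
       \<otimes>\<^bsub>ext_group\<^esub> inv\<^bsub>ext_group\<^esub> (lift 0 (e j (Suc j)) \<otimes>\<^bsub>ext_group\<^esub> E i j))"

lemma E_lift: "i < j \<Longrightarrow> j < n \<Longrightarrow> \<exists>x. E i j = lift x (e i j)"
proof (induction j)
  case (Suc j)
  show ?case
  proof (cases "i = j")
    case False
    let ?d = "lift 0 (e j (Suc j))"
    from Suc False obtain x where x: "E i j = lift x (e i j)" by auto
    have c: "E i (Suc j) \<in> carrier ext_group" using False Suc by (simp add: x)
    have "e i (Suc j) \<otimes>\<^bsub>U\<^esub> (e j (Suc j) \<otimes>\<^bsub>U\<^esub> e i j) = e i j \<otimes>\<^bsub>U\<^esub> e j (Suc j)"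
      using e_rel[of i j "Suc j"] Suc False by (simp add: m_assoc)
    moreover have "snd (E i (Suc j)) = e i j \<otimes>\<^bsub>U\<^esub> e j (Suc j) \<otimes>\<^bsub>U\<^esub> inv\<^bsub>U\<^esub> (e j (Suc j) \<otimes>\<^bsub>U\<^esub> e i j)"
    proof -
      interpret snd: group_hom ext_group U snd by (rule snd_hom)
      show ?thesis using Suc False by (simp add: x)
    qed
    ultimately have "snd (E i (Suc j)) = e i (Suc j)"
      using Suc False by (simp add: inv_solve_right')
    then show ?thesis
      using c by (metis carrier_ext_groupE snd_lift)
  qed auto
qed simp

lemma E_closed: "i < j \<Longrightarrow> j < n \<Longrightarrow> E i j \<in> carrier ext_group"
  using E_lift[of i j] by auto

lemma snd_E: "i < j \<Longrightarrow> j < n \<Longrightarrow> snd (E i j) = e i j"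
  using E_lift[of i j] by auto

lemma E_comm:
  assumes "i < j" "j < n" "k < l" "l < n" "j \<noteq> k" "i \<noteq> l"
  shows "E i j \<otimes>\<^bsub>ext_group\<^esub> E k l = E k l \<otimes>\<^bsub>ext_group\<^esub> E i j"
proof -
  obtain x y where "E i j = lift x (e i j)" "E k l = lift y (e k l)"
    using E_lift assms by meson
  then show ?thesis
    using lift_commute_iff[OF e_comm[OF assms]] e_tau_trivial[OF assms] by simp
qed

text \<open>Induction on the right end. The case k = j + 1 is the definition of \<open>E\<close>.
  Otherwise \<open>E j k\<close> is a commutator whose last factor commutes with
  \<open>E i j\<close>, and the relation for the shorter right end is pushed through it.\<close>

lemma E_rel:
  assumes "i < j" "j < k" "k < n"
  shows "E i j \<otimes>\<^bsub>ext_group\<^esub> E j k = E i k \<otimes>\<^bsub>ext_group\<^esub> E j k \<otimes>\<^bsub>ext_group\<^esub> E i j"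
  using assms(2,3)
proof (induction k)
  case (Suc c)
  have base: "E i c \<otimes>\<^bsub>ext_group\<^esub> E c (Suc c) = E i (Suc c) \<otimes>\<^bsub>ext_group\<^esub> E c (Suc c) \<otimes>\<^bsub>ext_group\<^esub> E i c"
    if "i < c" for i
    using that Suc.prems E_closed[of i c] by (simp add: ext.m_assoc)
  show ?case
  proof (cases "j = c")
    case True
    then show ?thesis using base assms by simp
  next
    case False
    then have jc: "j < c" using Suc by simp
    \<comment> \<open>In commutator notation z = [a,b], y = [b,d] and x = [z,d]. The claim is x =
      [a,y].\<close>
    define a b d y z x where "a = E i j" "b = E j c" "d = E c (Suc c)" "y = E j (Suc c)" "z = E i c" "x = E i (Suc c)"
    note defs = this
    have [simp]: "a \<in> carrier ext_group" "b \<in> carrier ext_group" "d \<in> carrier ext_group"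
      "y \<in> carrier ext_group" "z \<in> carrier ext_group" "x \<in> carrier ext_group"
      unfolding defs using Suc.prems jc assms by (auto simp del: E.simps intro!: E_closed)
    note [simp] = ext.m_assoc
    have ab: "a \<otimes>\<^bsub>ext_group\<^esub> b = z \<otimes>\<^bsub>ext_group\<^esub> (b \<otimes>\<^bsub>ext_group\<^esub> a)"
      using Suc.IH Suc.prems jc E_closed assms unfolding defs by simp
    have bd: "b \<otimes>\<^bsub>ext_group\<^esub> d = y \<otimes>\<^bsub>ext_group\<^esub> (d \<otimes>\<^bsub>ext_group\<^esub> b)"
      using base[OF jc] by (simp add: defs[symmetric] del: E.simps)
    have zd: "z \<otimes>\<^bsub>ext_group\<^esub> d = x \<otimes>\<^bsub>ext_group\<^esub> (d \<otimes>\<^bsub>ext_group\<^esub> z)"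
      using base[of i] assms jc by (simp add: defs[symmetric] del: E.simps)
    have comm: "a \<otimes>\<^bsub>ext_group\<^esub> d = d \<otimes>\<^bsub>ext_group\<^esub> a" "z \<otimes>\<^bsub>ext_group\<^esub> y = y \<otimes>\<^bsub>ext_group\<^esub> z"
      "x \<otimes>\<^bsub>ext_group\<^esub> y = y \<otimes>\<^bsub>ext_group\<^esub> x"
      unfolding defs using Suc.prems jc assms by (auto simp del: E.simps intro!: E_comm)
    have "a \<otimes>\<^bsub>ext_group\<^esub> y \<otimes>\<^bsub>ext_group\<^esub> (d \<otimes>\<^bsub>ext_group\<^esub> b) = (a \<otimes>\<^bsub>ext_group\<^esub> b) \<otimes>\<^bsub>ext_group\<^esub> d"
      by (simp add: bd)
    also have "\<dots> = z \<otimes>\<^bsub>ext_group\<^esub> (b \<otimes>\<^bsub>ext_group\<^esub> d) \<otimes>\<^bsub>ext_group\<^esub> a"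
      by (simp add: ab comm(1))
    also have "\<dots> = (z \<otimes>\<^bsub>ext_group\<^esub> y) \<otimes>\<^bsub>ext_group\<^esub> d \<otimes>\<^bsub>ext_group\<^esub> b \<otimes>\<^bsub>ext_group\<^esub> a"
      by (simp add: bd)
    also have "\<dots> = y \<otimes>\<^bsub>ext_group\<^esub> (z \<otimes>\<^bsub>ext_group\<^esub> d) \<otimes>\<^bsub>ext_group\<^esub> b \<otimes>\<^bsub>ext_group\<^esub> a"
      unfolding comm by simp
    also have "\<dots> = (y \<otimes>\<^bsub>ext_group\<^esub> x) \<otimes>\<^bsub>ext_group\<^esub> d \<otimes>\<^bsub>ext_group\<^esub> (z \<otimes>\<^bsub>ext_group\<^esub> (b \<otimes>\<^bsub>ext_group\<^esub> a))"
      by (simp add: zd)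
    also have "\<dots> = (x \<otimes>\<^bsub>ext_group\<^esub> y) \<otimes>\<^bsub>ext_group\<^esub> (d \<otimes>\<^bsub>ext_group\<^esub> a) \<otimes>\<^bsub>ext_group\<^esub> b"
      unfolding ab[symmetric] comm(3) by simp
    also have "\<dots> = x \<otimes>\<^bsub>ext_group\<^esub> y \<otimes>\<^bsub>ext_group\<^esub> a \<otimes>\<^bsub>ext_group\<^esub> (d \<otimes>\<^bsub>ext_group\<^esub> b)"
      unfolding comm(1)[symmetric] by simp
    finally have "a \<otimes>\<^bsub>ext_group\<^esub> y = x \<otimes>\<^bsub>ext_group\<^esub> y \<otimes>\<^bsub>ext_group\<^esub> a"
      by (subst (asm) ext.right_cancel) simp_all
    then show ?thesis unfolding defs .
  qed
qed simp

end

lemma (in unitriangular) el_int_pow: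
  assumes ij: "i < j" "j < n"
  shows "e i j [^]\<^bsub>U\<^esub> (t::int) = el i j t"
proof (cases t)
  case (nonneg k)
  then show ?thesis using assms by (simp add: int_pow_int el_nat_pow)
next
  case (neg k)
  interpret group U by (rule group_UT)
  have "el i j (- int (Suc k)) \<otimes>\<^bsub>U\<^esub> el i j (int (Suc k)) = \<one>\<^bsub>U\<^esub>"
    using assms by (simp add: el_add el_zero del: of_nat_Suc)
  then have "inv\<^bsub>U\<^esub> el i j (int (Suc k)) = el i j (- int (Suc k))"
    using ij by (intro inv_equality) simp_all
  moreover have "e i j [^]\<^bsub>U\<^esub> Suc k = el i j (int (Suc k))"
    using el_nat_pow[OF ij] .
  ultimately show ?thesis
    unfolding neg using ij by (simp only: int_pow_neg_int el_closed)
qed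

context unitriangular_tori
begin

definition w where "w i = (SOME x. E i (Suc i) [^]\<^bsub>ext_group\<^esub> m = iota x)"

text \<open>Off the superdiagonal \<open>E i j\<close> is the commutator of \<open>E i r\<close> and
  \<open>E r j\<close>. Its m-th power is the commutator of the central element (E i r)^m with
  \<open>E r j\<close>, hence trivial.\<close>

lemma E_pow: assumes "Suc i < j" "j < n" shows "E i j [^]\<^bsub>ext_group\<^esub> m = \<one>\<^bsub>ext_group\<^esub>"
proof -
  define r where "r = Suc i"
  have r: "i < r" "r < j" using assms by (auto simp: r_def)
  have E[simp]: "E i r \<in> carrier ext_group" "E r j \<in> carrier ext_group" "E i j \<in> carrier ext_group"
    using r assms by (simp_all add: E_closed)
  have "E i r [^]\<^bsub>ext_group\<^esub> nat m \<otimes>\<^bsub>ext_group\<^esub> E r j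
      = E i j [^]\<^bsub>ext_group\<^esub> nat m \<otimes>\<^bsub>ext_group\<^esub> E r j \<otimes>\<^bsub>ext_group\<^esub> E i r [^]\<^bsub>ext_group\<^esub> nat m"
    by (rule ext.commutator_nat_pow[OF E]) (use r assms in \<open>auto intro!: E_rel E_comm\<close>)
  moreover have "E i r [^]\<^bsub>ext_group\<^esub> nat m \<otimes>\<^bsub>ext_group\<^esub> E r j
      = E r j \<otimes>\<^bsub>ext_group\<^esub> E i r [^]\<^bsub>ext_group\<^esub> nat m"
    using e_torsion[of i r] r assms by (intro nat_pow_central) (simp_all add: snd_E)
  ultimately have "E i j [^]\<^bsub>ext_group\<^esub> nat m = \<one>\<^bsub>ext_group\<^esub>"
    by (simp add: ext.m_assoc)
  then show ?thesis using m_ge_2 by (simp add: pow_nat)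
qed

lemma E_pow_simple: assumes "Suc i < n" shows "E i (Suc i) [^]\<^bsub>ext_group\<^esub> m = iota (w i)"
proof -
  have "snd (E i (Suc i) [^]\<^bsub>ext_group\<^esub> nat m) = \<one>\<^bsub>U\<^esub>"
    using group_hom.hom_nat_pow[OF snd_hom, of "E i (Suc i)" "nat m"] assms e_torsion[of i "Suc i"]
    by simp
  moreover have "E i (Suc i) [^]\<^bsub>ext_group\<^esub> nat m \<in> carrier ext_group"
    using assms by (intro ext.nat_pow_closed E_closed) auto
  ultimately obtain x where "E i (Suc i) [^]\<^bsub>ext_group\<^esub> nat m = iota x"
    by (metis carrier_ext_groupE snd_lift lift_one_eq_iota)
  moreover have "E i (Suc i) [^]\<^bsub>ext_group\<^esub> nat m = E i (Suc i) [^]\<^bsub>ext_group\<^esub> m"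
    using m_ge_2 by (intro pow_nat) simp
  ultimately show ?thesis
    unfolding w_def by (intro someI[of "\<lambda>x. E i (Suc i) [^]\<^bsub>ext_group\<^esub> m = iota x" x]) (simp only:)
qed

sublocale st: steinberg_mod ext_group E n m iota w
  by unfold_locales
     (fact E_closed E_comm E_rel iota_closed iota_add iota_central E_pow E_pow_simple)+

lemma snd_pcol:
  assumes "k < n" "r \<le> k"
  shows "snd (st.pcol k v r) = (\<lambda>i j. if i < n \<and> j < n then
    (if i = j then 1 else if j = k \<and> i < r then v i mod m else 0) else 0)" (is "_ = ?M r")
  using assms(2)
proof (induction r)
  case 0
  then show ?case using assms by (auto simp: ext_one UT_one fun_eq_iff)
next
  case (Suc r)
  interpret snd: group_hom ext_group U snd by (rule snd_hom)
  have M: "?M s \<in> carrier U" if "s \<le> k" for s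
    using that assms m_ge_2 by (auto simp: UT_carrier_iff)
  have E: "E r k \<in> carrier ext_group" using Suc.prems assms by (simp add: E_closed)
  have "snd (st.pcol k v (Suc r)) = ?M r \<otimes>\<^bsub>U\<^esub> el r k (v r)"
    using Suc assms E snd.hom_int_pow[OF E, of "v r"] by (simp add: snd_E el_int_pow)
  also have "\<dots> = ?M (Suc r)"
  proof (rule UT_eqI)
    fix i j :: nat assume ij: "i < j" "j < n"
    then show "(?M r \<otimes>\<^bsub>U\<^esub> el r k (v r)) i j = ?M (Suc r) i j"
      using Suc.prems assms by (subst mult_el[OF M]) (auto simp: less_Suc_eq)
  qed (use Suc.prems M assms in \<open>auto intro!: UT_mult_closed\<close>)
  finally show ?case .
qed

lemma snd_mat_word:
  assumes "r \<le> n"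
  shows "snd (st.mat_word r A) = (\<lambda>i j. if i < n \<and> j < n then
    (if i = j then 1 else if i < j \<and> j < r then A i j mod m else 0) else 0)" (is "_ = ?M r")
  using assms
proof (induction r)
  case 0
  then show ?case by (auto simp: ext_one UT_one fun_eq_iff)
next
  case (Suc r)
  interpret snd: group_hom ext_group U snd by (rule snd_hom)
  let ?C = "\<lambda>i j. if i < n \<and> j < n then (if i = j then 1 else if j = r \<and> i < r then A i r mod m else 0) else 0"
  have M: "?M s \<in> carrier U" for s
    using m_ge_2 by (auto simp: UT_carrier_iff)
  have C: "?C \<in> carrier U"
    using m_ge_2 by (auto simp: UT_carrier_iff)
  have "snd (st.mat_word (Suc r) A) = ?C \<otimes>\<^bsub>U\<^esub> ?M r"
    using Suc snd_pcol[of r r "\<lambda>i. A i r"] by simp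
  also have "\<dots> = ?M (Suc r)"
  proof (rule UT_eqI[OF UT_mult_closed[OF C M] M])
    fix i j :: nat assume ij: "i < j" "j < n"
    have "(\<Sum>k\<in>{i<..<j}. ?C i k * ?M r k j) = 0"
      by (rule sum.neutral) auto
    then show "(?C \<otimes>\<^bsub>U\<^esub> ?M r) i j = ?M (Suc r) i j"
      using ij Suc.prems by (subst UT_mult_entry[OF C M ij]) (auto simp: less_Suc_eq)
  qed
  finally show ?case .
qed

text \<open>The carry of adding residues in a superdiagonal position; m times it is the integral
  coboundary of that matrix entry.\<close>

definition carry :: "nat \<Rightarrow> (nat \<Rightarrow> nat \<Rightarrow> int) \<Rightarrow> (nat \<Rightarrow> nat \<Rightarrow> int) \<Rightarrow> int" where
  "carry k g h = (g k (Suc k) + h k (Suc k)) div m"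

text \<open>Coefficient coordinate of the set-theoretic section that reads g as an integer matrix
  and takes its word.\<close>

definition section_cochain where "section_cochain g = fst (st.mat_word n g)"

lemma mat_word_lift:
  assumes "g \<in> carrier U"
  shows "st.mat_word n g = lift (section_cochain g) g"
proof -
  have "snd (st.mat_word n g) = g"
    using assms UT_entry_range[OF assms]
    by (auto simp: snd_mat_word fun_eq_iff UT_diag UT_lower UT_outside not_less)
  moreover obtain x g' where "st.mat_word n g = lift x g'"
    by (meson carrier_ext_groupE st.mat_word_closed order_refl)
  ultimately show ?thesis
    by (simp add: section_cochain_def lift_def)
qed

text \<open>The words of g and h multiply to the word of the unreduced integer product. Reducing its
  entries modulo m costs only the central elements attached to the superdiagonal carries.\<close>

theorem cocycle_decomposition:
  assumes g: "g \<in> carrier U" and h: "h \<in> carrier U"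
  shows "u g h + section_cochain g + section_cochain h - section_cochain (g \<otimes>\<^bsub>U\<^esub> h)
    - (\<Sum>k<n - 1. of_int (carry k g h) * w k) \<in> H"
proof -
  let ?P = "\<lambda>i k. g i k + h i k + (\<Sum>j\<in>{i<..<k}. g i j * h j k)"
  let ?S = "\<Sum>k<n - 1. of_int (carry k g h) * w k"
  have gh: "g \<otimes>\<^bsub>U\<^esub> h \<in> carrier U" using g h by simp
  have "lift (section_cochain g) g \<otimes>\<^bsub>ext_group\<^esub> lift (section_cochain h) h = st.mat_word n ?P"
    using st.mat_word_mult[of n g h] g h by (simp add: mat_word_lift)
  also have "\<dots> = st.mat_word n (\<lambda>i k. (g \<otimes>\<^bsub>U\<^esub> h) i k + m * (?P i k div m))"
    using g h by (intro st.mat_word_cong) (simp add: UT_mult_entry mod_mult_div_eq)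
  also have "\<dots> = lift (section_cochain (g \<otimes>\<^bsub>U\<^esub> h)) (g \<otimes>\<^bsub>U\<^esub> h) \<otimes>\<^bsub>ext_group\<^esub> iota ?S"
  proof -
    \<comment> \<open>A superdiagonal entry of the product has no inner sum, so its quotient by m is
      the carry.\<close>
    have "{k<..<Suc k} = {}" for k :: nat by auto
    then show ?thesis using gh by (subst st.mat_word_add_mult_m) (simp_all add: mat_word_lift carry_def)
  qed
  also have "\<dots> = iota ?S \<otimes>\<^bsub>ext_group\<^esub> lift (section_cochain (g \<otimes>\<^bsub>U\<^esub> h)) (g \<otimes>\<^bsub>U\<^esub> h)"
    using gh by (simp add: iota_central)
  also have "\<dots> = lift (?S + section_cochain (g \<otimes>\<^bsub>U\<^esub> h)) (g \<otimes>\<^bsub>U\<^esub> h)"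
    using gh by (rule iota_mult_lift)
  finally show ?thesis
    by (simp add: lift_mult lift_eq_iff algebra_simps)
qed

end

section \<open>Chains of the bar complex\<close>

lemma of_int_fun_apply: "(of_int k :: 'a \<Rightarrow> 'b :: comm_ring_1) x = of_int k"
  by (cases k) (simp_all del: of_nat_Suc)

lemma minus_fun_apply: "(f - g) x = f x - (g x :: 'b :: group_add)"
  by (simp add: fun_diff_def)

lemma sum_fun_apply: "(\<Sum>i\<in>I. f i) x = (\<Sum>i\<in>I. f i x :: 'b :: comm_monoid_add)"
  by (induction I rule: infinite_finite_induct) simp_all

lemmas fun_apply = of_int_fun_apply minus_fun_apply sum_fun_apply plus_fun_apply zero_fun_apply
  times_fun_apply

(* As simp rules these would eta-expand chains. *)
declare plus_fun_apply [simp del] zero_fun_apply [simp del] times_fun_apply [simp del]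
  of_nat_fun_apply [simp del]

definition basis_chain :: "'b \<Rightarrow> 'b \<Rightarrow> int" where
  "basis_chain p = (\<lambda>q. if q = p then 1 else 0)"

definition pairing :: "('a, 'b) monoid_scheme \<Rightarrow> ('a \<Rightarrow> 'a \<Rightarrow> int) \<Rightarrow> ('a \<times> 'a \<Rightarrow> int) \<Rightarrow> int" where
  "pairing G c f = (\<Sum>(g,h)\<in>carrier G \<times> carrier G. f (g, h) * c g h)"

lemma pairing_add: "pairing G c (f + f') = pairing G c f + pairing G c f'"
  by (simp add: pairing_def split_def distrib_right sum.distrib fun_apply)

lemma pairing_of_int_mult: "pairing G c (of_int k * f) = k * pairing G c f"
  by (simp add: pairing_def split_def sum_distrib_left mult.assoc fun_apply)

lemma pairing_diff: "pairing G c (f - f') = pairing G c f - pairing G c f'"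
  by (simp add: pairing_def split_def left_diff_distrib sum_subtractf fun_apply)

lemma pairing_zero [simp]: "pairing G c 0 = 0"
  by (simp add: pairing_def fun_apply)

lemma pairing_sum: "pairing G c (\<Sum>i\<in>I. f i) = (\<Sum>i\<in>I. pairing G c (f i))"
  by (induction I rule: infinite_finite_induct) (simp_all add: pairing_add)

lemma chains2_add: "f \<in> chains2 G \<Longrightarrow> f' \<in> chains2 G \<Longrightarrow> f + f' \<in> chains2 G"
  and chains2_of_int_mult: "f \<in> chains2 G \<Longrightarrow> of_int k * f \<in> chains2 G"
  by (simp_all add: chains2_def fun_apply)

lemma bar_d2_eq_pairing:
  "bar_d2 G f x = (if x \<in> carrier G then pairing G (\<lambda>g h. (if h = x then 1 else 0)
     - (if g \<otimes>\<^bsub>G\<^esub> h = x then 1 else 0) + (if g = x then 1 else 0)) f else 0)"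
  by (simp add: bar_d2_def pairing_def)

lemma bar_d2_add: "bar_d2 G (f + f') x = bar_d2 G f x + bar_d2 G f' x"
  and bar_d2_of_int_mult: "bar_d2 G (of_int k * f) x = k * bar_d2 G f x"
  and bar_d2_zero: "bar_d2 G 0 x = 0"
  by (simp_all add: bar_d2_eq_pairing pairing_add pairing_of_int_mult)

lemma cycles2_iff: "f \<in> cycles2 G \<longleftrightarrow> f \<in> chains2 G \<and> (\<forall>x. bar_d2 G f x = 0)"
  by (auto simp: cycles2_def)

lemma cycles2_add: "f \<in> cycles2 G \<Longrightarrow> f' \<in> cycles2 G \<Longrightarrow> f + f' \<in> cycles2 G"
  and cycles2_of_int_mult: "f \<in> cycles2 G \<Longrightarrow> of_int k * f \<in> cycles2 G"
  and cycles2_zero: "0 \<in> cycles2 G"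
  by (simp_all add: cycles2_iff bar_d2_add bar_d2_of_int_mult bar_d2_zero chains2_add chains2_of_int_mult)
     (simp add: chains2_def fun_apply)

lemma cycles2_sum: "(\<And>i. i \<in> I \<Longrightarrow> f i \<in> cycles2 G) \<Longrightarrow> (\<Sum>i\<in>I. f i) \<in> cycles2 G"
  by (induction I rule: infinite_finite_induct) (auto simp: cycles2_add cycles2_zero)

lemma group_cycles2: "group (cycles2_group G)"
proof (rule groupI)
  fix f assume "f \<in> carrier (cycles2_group G)"
  then have "of_int (-1) * f \<in> cycles2 G"
    unfolding cycles2_group_def by (intro cycles2_of_int_mult) simp
  then show "\<exists>f'\<in>carrier (cycles2_group G). f' \<otimes>\<^bsub>cycles2_group G\<^esub> f = \<one>\<^bsub>cycles2_group G\<^esub>"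
    by (intro bexI[of _ "of_int (-1) * f"]) (auto simp: cycles2_group_def fun_eq_iff fun_apply)
qed (use cycles2_add cycles2_zero in \<open>auto simp: cycles2_group_def plus_fun_def zero_fun_def add.assoc\<close>)

lemma boundaries2_diff:
  assumes "f \<in> boundaries2 G" "f' \<in> boundaries2 G"
  shows "f - f' \<in> boundaries2 G"
proof -
  obtain F F' where F: "f = bar_d3 G F" "f' = bar_d3 G F'" "F \<in> chains3 G" "F' \<in> chains3 G"
    using assms by (auto simp: boundaries2_def)
  have "bar_d3 G (F - F') = f - f'"
    by (auto simp: F bar_d3_def fun_apply fun_eq_iff left_diff_distrib sum_subtractf split_def)
  moreover have "F - F' \<in> chains3 G" using F by (auto simp: chains3_def fun_apply)
  ultimately show ?thesis unfolding boundaries2_def by (metis imageI)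
qed

lemma boundaries2_zero: "0 \<in> boundaries2 G"
proof -
  have "bar_d3 G 0 = 0" "0 \<in> chains3 G" by (auto simp: bar_d3_def chains3_def fun_eq_iff split_def fun_apply)
  then show ?thesis unfolding boundaries2_def by (metis imageI)
qed

lemma boundaries2_add:
  assumes "f \<in> boundaries2 G" "f' \<in> boundaries2 G"
  shows "f + f' \<in> boundaries2 G"
  using boundaries2_diff[OF assms(1) boundaries2_diff[OF boundaries2_zero assms(2)]] by simp

lemma boundaries2_of_int_mult:
  assumes f: "f \<in> boundaries2 G"
  shows "of_int k * f \<in> boundaries2 G"
proof -
  have "of_nat k * f \<in> boundaries2 G" for k
    by (induction k) (simp_all add: boundaries2_zero distrib_right boundaries2_add f)
  then show ?thesis
    using boundaries2_diff[OF boundaries2_zero] by (cases k) (fastforce simp del: of_nat_Suc)+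
qed

lemma boundaries2_sum: "(\<And>i. i \<in> I \<Longrightarrow> f i \<in> boundaries2 G) \<Longrightarrow> (\<Sum>i\<in>I. f i) \<in> boundaries2 G"
  by (induction I rule: infinite_finite_induct) (auto simp: boundaries2_add boundaries2_zero)

lemma group_cyc_prod:
  assumes pos: "\<And>d. d \<in> set ds \<Longrightarrow> 0 < d"
  shows "group (cyc_prod ds)"
proof (rule groupI)
  fix v assume v: "v \<in> carrier (cyc_prod ds)"
  let ?w = "\<lambda>i. if i < length ds then (- v i) mod ds ! i else 0"
  have "?w \<in> carrier (cyc_prod ds)"
    using pos by (auto simp: cyc_prod_def)
  moreover have "?w \<otimes>\<^bsub>cyc_prod ds\<^esub> v = \<one>\<^bsub>cyc_prod ds\<^esub>"
    by (auto simp: cyc_prod_def fun_eq_iff mod_add_left_eq)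
  ultimately show "\<exists>w\<in>carrier (cyc_prod ds). w \<otimes>\<^bsub>cyc_prod ds\<^esub> v = \<one>\<^bsub>cyc_prod ds\<^esub>" by blast
qed (use pos in \<open>auto simp: cyc_prod_def fun_eq_iff mod_simps add.assoc\<close>)

section \<open>Cochains evaluated on boundaries and cycles\<close>

context group
begin

lemma bar_d3_basis:
  assumes fin: "finite (carrier G)" and [simp]: "g \<in> carrier G" "h \<in> carrier G" "k \<in> carrier G"
  shows "basis_chain (h, k) - basis_chain (g \<otimes> h, k) + basis_chain (g, h \<otimes> k) - basis_chain (g, h)
    \<in> boundaries2 G"
proof -
  let ?F = "basis_chain (g, h, k)"
  have "bar_d3 G ?F y = (basis_chain (h, k) - basis_chain (g \<otimes> h, k) + basis_chain (g, h \<otimes> k)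
      - basis_chain (g, h)) y" for y
  proof (cases "y \<in> carrier G \<times> carrier G")
    case True
    let ?t = "\<lambda>(g,h,k). (if (h,k) = y then 1 else 0) - (if (g \<otimes> h, k) = y then 1 else 0)
          + (if (g, h \<otimes> k) = y then 1 else 0) - (if (g,h) = y then 1 else 0 :: int)"
    have "bar_d3 G ?F y = (\<Sum>p\<in>carrier G \<times> carrier G \<times> carrier G. ?F p * ?t p)"
      unfolding bar_d3_def if_P[OF True] split_def by simp
    also have "\<dots> = (\<Sum>p\<in>carrier G \<times> carrier G \<times> carrier G. if p = (g, h, k) then ?t (g, h, k) else 0)"
      by (rule sum.cong[OF refl]) (simp add: basis_chain_def)
    also have "\<dots> = ?t (g, h, k)" using fin by simp
    finally show ?thesis by (simp add: basis_chain_def fun_apply eq_commute[of y])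
  next
    case False
    then have "y \<noteq> (h, k)" "y \<noteq> (g \<otimes> h, k)" "y \<noteq> (g, h \<otimes> k)" "y \<noteq> (g, h)"
      using m_closed by force+
    then show ?thesis unfolding bar_d3_def if_not_P[OF False] by (simp add: fun_apply basis_chain_def)
  qed
  then have "bar_d3 G ?F = basis_chain (h, k) - basis_chain (g \<otimes> h, k) + basis_chain (g, h \<otimes> k)
      - basis_chain (g, h)" by (rule ext)
  moreover have "?F \<in> chains3 G" by (auto simp: chains3_def basis_chain_def)
  ultimately show ?thesis unfolding boundaries2_def by (metis imageI)
qed

lemma pairing_basis:
  assumes fin: "finite (carrier G)" and [simp]: "g \<in> carrier G" "h \<in> carrier G"
  shows "pairing G c (basis_chain (g, h)) = c g h"
proof -
  have "pairing G c (basis_chain (g, h)) = (\<Sum>p\<in>carrier G \<times> carrier G. if p = (g, h) then c g h else 0)"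
    unfolding pairing_def by (auto simp: basis_chain_def intro!: sum.cong)
  then show ?thesis using fin by simp
qed

lemma chain_eq_sum:
  assumes fin: "finite (carrier G)" and f: "f \<in> chains2 G"
  shows "f = (\<Sum>p\<in>carrier G \<times> carrier G. of_int (f p) * basis_chain p)"
proof
  fix q
  have "(\<Sum>p\<in>carrier G \<times> carrier G. f p * basis_chain p q)
      = (\<Sum>p\<in>carrier G \<times> carrier G. if p = q then f q else 0)"
    by (auto simp: basis_chain_def intro!: sum.cong)
  also have "\<dots> = f q" using fin f by (cases q) (auto simp: chains2_def)
  finally show "f q = (\<Sum>p\<in>carrier G \<times> carrier G. of_int (f p) * basis_chain p) q" by (simp add: fun_apply)
qed

text \<open>Adjointness of d3 and the coboundary, obtained by expanding \<open>bar_d3 G F\<close> in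
  basis chains and pairing termwise.\<close>

lemma pairing_bar_d3:
  assumes fin: "finite (carrier G)"
  shows "pairing G c (bar_d3 G F) = (\<Sum>(g,h,k)\<in>carrier G \<times> carrier G \<times> carrier G.
    F (g,h,k) * (c h k - c (g \<otimes> h) k + c g (h \<otimes> k) - c g h))"
proof -
  let ?G2 = "carrier G \<times> carrier G" and ?G3 = "carrier G \<times> carrier G \<times> carrier G"
  let ?s = "\<lambda>(g,h,k). basis_chain (h, k) - basis_chain (g \<otimes> h, k) + basis_chain (g, h \<otimes> k) - basis_chain (g, h)"
  have "pairing G c (bar_d3 G F) = pairing G c (\<Sum>p\<in>?G3. of_int (F p) * ?s p)"
    unfolding pairing_def
  proof (rule sum.cong[OF refl], clarify)
    fix x y assume "x \<in> carrier G" "y \<in> carrier G"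
    then have xy: "(x, y) \<in> ?G2" by simp
    have "bar_d3 G F (x, y) = (\<Sum>p\<in>?G3. of_int (F p) * ?s p) (x, y)"
      unfolding bar_d3_def if_P[OF xy] sum_fun_apply split_def
      by (rule sum.cong[OF refl])
         (simp add: fun_apply basis_chain_def eq_commute[of x] eq_commute[of y])
    then show "bar_d3 G F (x, y) * c x y = (\<Sum>p\<in>?G3. of_int (F p) * ?s p) (x, y) * c x y" by simp
  qed
  also have "\<dots> = (\<Sum>p\<in>?G3. F p * pairing G c (?s p))"
    by (simp only: pairing_sum pairing_of_int_mult)
  also have "\<dots> = (\<Sum>(g,h,k)\<in>?G3. F (g,h,k) * (c h k - c (g \<otimes> h) k + c g (h \<otimes> k) - c g h))"
    by (rule sum.cong) (auto simp: pairing_add pairing_diff pairing_basis fin)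
  finally show ?thesis .
qed

lemma pairing_boundary_dvd:
  assumes fin: "finite (carrier G)" and f: "f \<in> boundaries2 G"
    and c: "\<And>g h k. g \<in> carrier G \<Longrightarrow> h \<in> carrier G \<Longrightarrow> k \<in> carrier G \<Longrightarrow>
      d dvd c h k - c (g \<otimes> h) k + c g (h \<otimes> k) - c g h"
  shows "d dvd pairing G c f"
proof -
  obtain F where "f = bar_d3 G F" using f by (auto simp: boundaries2_def)
  then show ?thesis
    by (simp only: pairing_bar_d3[OF fin] split_def) (rule dvd_sum, rule dvd_mult, rule c, auto)
qed

lemma boundaries2_subset: assumes fin: "finite (carrier G)" shows "boundaries2 G \<subseteq> cycles2 G"
proof
  fix f assume f: "f \<in> boundaries2 G"
  \<comment> \<open>Divisibility by 0 means vanishing. The coefficient of d2 at x is the pairing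
    with the coboundary of the indicator of x, an exact cocycle.\<close>
  have "0 dvd bar_d2 G f x" for x
    unfolding bar_d2_eq_pairing using pairing_boundary_dvd[OF fin f, of 0]
    by (auto simp: m_assoc)
  moreover have "f \<in> chains2 G" using f by (auto simp: boundaries2_def chains2_def bar_d3_def)
  ultimately show "f \<in> cycles2 G" by (auto simp: cycles2_iff)
qed

text \<open>The target ring is general because b is integer-valued when carries are removed and
  chain-valued when the section cochain is removed.\<close>

lemma coboundary_on_cycle:
  fixes b :: "'a \<Rightarrow> 'm :: comm_ring_1"
  assumes fin: "finite (carrier G)" and f: "f \<in> cycles2 G"
  shows "(\<Sum>(g,h)\<in>carrier G \<times> carrier G. of_int (f (g,h)) * (b g + b h - b (g \<otimes> h))) = 0"
proof -
  let ?G2 = "carrier G \<times> carrier G"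
  let ?e = "\<lambda>x (g,h). (if h = x then 1 else 0) - (if g \<otimes> h = x then 1 else 0) + (if g = x then 1 else 0 :: int)"
  have "(\<Sum>(g,h)\<in>?G2. of_int (f (g,h)) * (b g + b h - b (g \<otimes> h)))
      = (\<Sum>p\<in>?G2. \<Sum>x\<in>carrier G. of_int (f p * ?e x p) * b x)"
  proof (rule sum.cong[OF refl])
    fix p assume "p \<in> ?G2"
    then obtain g h where p: "p = (g, h)" and gh: "g \<in> carrier G" "h \<in> carrier G" by auto
    have "(\<Sum>x\<in>carrier G. of_int (?e x (g, h)) * b x) = (\<Sum>x\<in>carrier G.
       (if x = h then b h else 0) - (if x = g \<otimes> h then b (g \<otimes> h) else 0) + (if x = g then b g else 0))"
      by (rule sum.cong) auto
    also have "\<dots> = b g + b h - b (g \<otimes> h)"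
      using fin gh by (simp add: sum.distrib sum_subtractf)
    finally show "(case p of (g, h) \<Rightarrow> of_int (f (g,h)) * (b g + b h - b (g \<otimes> h)))
        = (\<Sum>x\<in>carrier G. of_int (f p * ?e x p) * b x)"
      by (simp only: p of_int_mult mult.assoc sum_distrib_left[symmetric] prod.case)
  qed
  also have "\<dots> = (\<Sum>x\<in>carrier G. of_int (\<Sum>p\<in>?G2. f p * ?e x p) * b x)"
    by (subst sum.swap) (simp add: sum_distrib_right)
  also have "\<dots> = (\<Sum>x\<in>carrier G. of_int (bar_d2 G f x) * b x)"
    by (rule sum.cong) (auto simp: bar_d2_def split_def)
  also have "\<dots> = 0" using f by (simp add: cycles2_iff)
  finally show ?thesis .
qed

text \<open>The generating cycles have orders dividing \<open>d x\<close>, and the dual cocycles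
  show that no smaller orders and no further relations occur. Pairing with all cocycles therefore
  induces the isomorphism.\<close>

theorem schur_multiplier_dual_basis:
  fixes idx :: "'i list" and d :: "'i \<Rightarrow> int"
    and c :: "'i \<Rightarrow> 'a \<Rightarrow> 'a \<Rightarrow> int" and t :: "'i \<Rightarrow> 'a \<times> 'a \<Rightarrow> int"
  assumes fin: "finite (carrier G)" and dist: "distinct idx"
    and pos: "\<And>x. x \<in> set idx \<Longrightarrow> 0 < d x"
    and cocycle: "\<And>x g h k. x \<in> set idx \<Longrightarrow> g \<in> carrier G \<Longrightarrow> h \<in> carrier G \<Longrightarrow> k \<in> carrier G \<Longrightarrow>
      d x dvd c x h k - c x (g \<otimes> h) k + c x g (h \<otimes> k) - c x g h"
    and cycle: "\<And>x. x \<in> set idx \<Longrightarrow> t x \<in> cycles2 G"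
    and dual: "\<And>x y. x \<in> set idx \<Longrightarrow> y \<in> set idx \<Longrightarrow>
      d x dvd pairing G (c x) (t y) - (if x = y then 1 else 0)"
    and torsion: "\<And>x. x \<in> set idx \<Longrightarrow> of_int (d x) * t x \<in> boundaries2 G"
    and gen: "\<And>H. 0 \<in> H \<Longrightarrow> (\<And>x y. x \<in> H \<Longrightarrow> y \<in> H \<Longrightarrow> x - y \<in> H) \<Longrightarrow> boundaries2 G \<subseteq> H \<Longrightarrow>
      t ` set idx \<subseteq> H \<Longrightarrow> cycles2 G \<subseteq> H"
  shows "schur_multiplier G \<cong> cyc_prod (map d idx)"
proof -
  let ?N = "length idx"
  define comb where "comb a = (\<Sum>i<?N. of_int (a i) * t (idx ! i))" for a :: "nat \<Rightarrow> int"
  define \<phi> where "\<phi> f = (\<lambda>i. if i < ?N then pairing G (c (idx ! i)) f mod d (idx ! i) else 0)" for f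
  have comb_cycle: "comb a \<in> cycles2 G" for a
    unfolding comb_def using cycle by (intro cycles2_sum cycles2_of_int_mult) auto
  have phi_comb: "\<phi> (comb a + b) = (\<lambda>i. if i < ?N then a i mod d (idx ! i) else 0)"
    if b: "b \<in> boundaries2 G" for a b
  proof
    fix i
    show "\<phi> (comb a + b) i = (if i < ?N then a i mod d (idx ! i) else 0)"
    proof (cases "i < ?N")
      case True
      let ?x = "idx ! i"
      have x: "?x \<in> set idx" using True by simp
      have "pairing G (c ?x) (comb a + b) - a i
          = (\<Sum>j<?N. a j * (pairing G (c ?x) (t (idx ! j)) - (if ?x = idx ! j then 1 else 0)))
            + pairing G (c ?x) b"
      proof -
        have "(\<Sum>j<?N. a j * (if ?x = idx ! j then 1 else 0)) = (\<Sum>j<?N. if j = i then a i else 0)"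
          using True dist by (intro sum.cong) (auto simp: nth_eq_iff_index_eq)
        also have "\<dots> = a i" using True by simp
        finally show ?thesis
          by (simp add: comb_def pairing_add pairing_sum pairing_of_int_mult right_diff_distrib sum_subtractf)
      qed
      moreover have "d ?x dvd \<dots>"
        using dual[OF x] pairing_boundary_dvd[OF fin b cocycle[OF x]] by (intro dvd_add dvd_sum) auto
      ultimately show ?thesis
        using True by (simp add: \<phi>_def mod_eq_dvd_iff)
    qed (simp add: \<phi>_def)
  qed
  have span: "\<exists>a b. b \<in> boundaries2 G \<and> f = comb a + b" if f: "f \<in> cycles2 G" for f
  proof -
    let ?H = "{comb a + b | a b. b \<in> boundaries2 G}"
    have comb_diff: "comb a - comb a' = comb (\<lambda>i. a i - a' i)" for a a'
      by (simp add: comb_def sum_subtractf left_diff_distrib)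
    have comb_zero: "comb (\<lambda>_. 0) = 0" by (simp add: comb_def)
    have H_boundary: "b \<in> ?H" if b: "b \<in> boundaries2 G" for b
    proof -
      have "comb (\<lambda>_. 0) + b \<in> ?H" using b by blast
      then show ?thesis unfolding comb_zero by simp
    qed
    have "cycles2 G \<subseteq> ?H"
    proof (rule gen)
      show "0 \<in> ?H" by (rule H_boundary[OF boundaries2_zero])
      show "boundaries2 G \<subseteq> ?H" using H_boundary by (rule subsetI)
      show "x - y \<in> ?H" if "x \<in> ?H" "y \<in> ?H" for x y
      proof -
        obtain a b a' b' where *: "x = comb a + b" "y = comb a' + b'"
          "b \<in> boundaries2 G" "b' \<in> boundaries2 G" using \<open>x \<in> ?H\<close> \<open>y \<in> ?H\<close> by auto
        have "x - y = comb (\<lambda>i. a i - a' i) + (b - b')"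
          unfolding * comb_diff[symmetric] by simp
        then show ?thesis using boundaries2_diff[OF *(3,4)] by blast
      qed
      show "t ` set idx \<subseteq> ?H"
      proof clarify
        fix x assume "x \<in> set idx"
        then obtain i where i: "i < ?N" "x = idx ! i" by (auto simp: in_set_conv_nth)
        have "comb (\<lambda>j. if j = i then 1 else 0) = (\<Sum>j<?N. if j = i then t x else 0)"
          unfolding comb_def by (intro sum.cong) (auto simp: i)
        also have "\<dots> = t x" using i by simp
        finally have "t x = comb (\<lambda>j. if j = i then 1 else 0) + 0" by simp
        then show "\<exists>a b. t x = comb a + b \<and> b \<in> boundaries2 G" using boundaries2_zero by blast
      qed
    qed
    then show ?thesis using f by blast
  qed
  interpret hom: group_hom "cycles2_group G" "cyc_prod (map d idx)" \<phi>
  proof (intro group_hom.intro group_hom_axioms.intro group_cycles2 group_cyc_prod homI)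
    fix f f' :: "'a \<times> 'a \<Rightarrow> int"
    have [simp]: "(\<lambda>x. f x + f' x) = f + f'" by (simp add: plus_fun_def)
    show "\<phi> (f \<otimes>\<^bsub>cycles2_group G\<^esub> f') = \<phi> f \<otimes>\<^bsub>cyc_prod (map d idx)\<^esub> \<phi> f'"
      by (auto simp: \<phi>_def cycles2_group_def cyc_prod_def pairing_add mod_simps fun_eq_iff)
  qed (use pos in \<open>auto simp: \<phi>_def cyc_prod_def\<close>)
  have surj: "\<phi> ` carrier (cycles2_group G) = carrier (cyc_prod (map d idx))"
  proof
    show "carrier (cyc_prod (map d idx)) \<subseteq> \<phi> ` carrier (cycles2_group G)"
    proof
      fix v assume "v \<in> carrier (cyc_prod (map d idx))"
      then have "v = \<phi> (comb v + 0)"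
        unfolding phi_comb[OF boundaries2_zero] by (auto simp: cyc_prod_def fun_eq_iff not_less)
      then show "v \<in> \<phi> ` carrier (cycles2_group G)"
        using comb_cycle by (auto simp: cycles2_group_def)
    qed
  qed auto
  have "kernel (cycles2_group G) (cyc_prod (map d idx)) \<phi> = boundaries2 G"
  proof (intro equalityI subsetI)
    fix f assume f: "f \<in> boundaries2 G"
    have "\<phi> (comb (\<lambda>_. 0) + f) = \<one>\<^bsub>cyc_prod (map d idx)\<^esub>"
      unfolding phi_comb[OF f] by (simp add: cyc_prod_def fun_eq_iff)
    then show "f \<in> kernel (cycles2_group G) (cyc_prod (map d idx)) \<phi>"
      using boundaries2_subset[OF fin] f by (auto simp: kernel_def cycles2_group_def comb_def)
  next
    fix f assume "f \<in> kernel (cycles2_group G) (cyc_prod (map d idx)) \<phi>"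
    then have f: "f \<in> cycles2 G" "\<phi> f = (\<lambda>_. 0)" by (auto simp: kernel_def cycles2_group_def cyc_prod_def)
    obtain a b where ab: "b \<in> boundaries2 G" "f = comb a + b" using span[OF f(1)] by blast
    \<comment> \<open>Vanishing of all pairings makes each coefficient a multiple of the order of
      its generator, so every summand bounds separately.\<close>
    have "of_int (a i) * t (idx ! i) \<in> boundaries2 G" if i: "i < ?N" for i
    proof -
      have "d (idx ! i) dvd a i"
        using f(2) i unfolding ab(2) phi_comb[OF ab(1)] by (auto simp: fun_eq_iff split: if_splits)
      then obtain q where "a i = q * d (idx ! i)" by (metis dvd_def mult.commute)
      then show ?thesis using boundaries2_of_int_mult[OF torsion, of "idx ! i" q] i by (simp add: mult.assoc)
    qed
    then have "comb a \<in> boundaries2 G"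
      unfolding comb_def by (intro boundaries2_sum) simp
    then show "f \<in> boundaries2 G" unfolding ab(2) by (intro boundaries2_add ab(1))
  qed
  then show ?thesis
    using hom.FactGroup_iso[OF surj] by (simp add: schur_multiplier_def)
qed

end

section \<open>Generation of the cycles by tori\<close>

context unitriangular
begin

definition torus where "torus g h = basis_chain (g, h) - basis_chain (h, g)"

theorem cycles2_generated_by_tori:
  assumes H: "0 \<in> H" "\<And>x y. x \<in> H \<Longrightarrow> y \<in> H \<Longrightarrow> x - y \<in> H" "boundaries2 U \<subseteq> H"
    and tori: "\<And>i j. Suc i < j \<Longrightarrow> Suc j < n \<Longrightarrow> torus (e i (Suc i)) (e j (Suc j)) \<in> H"
      "\<And>i. i + 2 < n \<Longrightarrow> torus (e i (i+2)) (e i (i+1)) \<in> H"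
      "\<And>i. i + 2 < n \<Longrightarrow> torus (e i (i+2)) (e (i+1) (i+2)) \<in> H"
      "\<And>i. i + 3 < n \<Longrightarrow> torus (e i (i+2)) (e (i+1) (i+3)) \<in> H"
  shows "cycles2 U \<subseteq> H"
proof
  interpret U: group U by (rule group_UT)
  interpret cocycle_mod U "\<lambda>g h. basis_chain (g, h)" H
    by unfold_locales (use H U.bar_d3_basis[OF finite_UT] in auto)
  interpret unitriangular_tori n m "\<lambda>g h. basis_chain (g, h)" H
    by unfold_locales (use tori in \<open>simp_all add: tau_def torus_def\<close>)
  let ?b = "\<lambda>g h. section_cochain g + section_cochain h - section_cochain (g \<otimes>\<^bsub>U\<^esub> h)"
  let ?G2 = "carrier U \<times> carrier U"
  fix f assume f: "f \<in> cycles2 U"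
  \<comment> \<open>m times the carry is an integer coboundary, which vanishes on cycles; then m is
    cancelled in the integers.\<close>
  have carry0: "(\<Sum>(g,h)\<in>?G2. f (g,h) * carry k g h) = 0" if k: "Suc k < n" for k
  proof -
    have "m * (\<Sum>(g,h)\<in>?G2. f (g,h) * carry k g h)
        = (\<Sum>(g,h)\<in>?G2. of_int (f (g,h)) * (g k (Suc k) + h k (Suc k) - (g \<otimes>\<^bsub>U\<^esub> h) k (Suc k)))"
    proof -
      have "{k<..<Suc k} = {}" by auto
      then have "m * carry k g h = g k (Suc k) + h k (Suc k) - (g \<otimes>\<^bsub>U\<^esub> h) k (Suc k)"
        if "g \<in> carrier U" "h \<in> carrier U" for g h
        using that k by (simp add: UT_mult_entry carry_def minus_mod_eq_mult_div)
      then show ?thesis unfolding sum_distrib_left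
        by (intro sum.cong) auto
    qed
    also have "\<dots> = 0" using U.coboundary_on_cycle[OF finite_UT f] .
    finally show ?thesis using m_ge_2 by simp
  qed
  have H_sum: "(\<Sum>i\<in>I. x i) \<in> H" if "\<And>i. i \<in> I \<Longrightarrow> x i \<in> H" for I :: "'z set" and x
    using that by (induction I rule: infinite_finite_induct) (auto simp: H_zero H_add)
  \<comment> \<open>Weighted by f and summed, the tautological cocycle gives back f, while the
    section and carry terms vanish on the cycle f.\<close>
  have "(\<Sum>(g,h)\<in>?G2. of_int (f (g,h)) * (basis_chain (g,h) + section_cochain g + section_cochain h
      - section_cochain (g \<otimes>\<^bsub>U\<^esub> h) - (\<Sum>k<n - 1. of_int (carry k g h) * w k))) \<in> H" (is "?L \<in> H")
    unfolding split_def by (intro H_sum H_of_int_mult cocycle_decomposition) auto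
  also have "?L = (\<Sum>p\<in>?G2. of_int (f p) * basis_chain p) + (\<Sum>(g,h)\<in>?G2. of_int (f (g,h)) * ?b g h)
      - (\<Sum>(g,h)\<in>?G2. \<Sum>k<n - 1. of_int (f (g,h)) * (of_int (carry k g h) * w k))"
    by (simp add: sum.distrib[symmetric] sum_subtractf[symmetric] sum_distrib_left split_def algebra_simps)
  also have "(\<Sum>p\<in>?G2. of_int (f p) * basis_chain p) = f"
    using U.chain_eq_sum[OF finite_UT, of f] f by (simp add: cycles2_iff)
  also have "(\<Sum>(g,h)\<in>?G2. of_int (f (g,h)) * ?b g h) = 0"
    by (rule U.coboundary_on_cycle[OF finite_UT f])
  also have "(\<Sum>(g,h)\<in>?G2. \<Sum>k<n - 1. of_int (f (g,h)) * (of_int (carry k g h) * w k))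
      = (\<Sum>k<n - 1. of_int (\<Sum>(g,h)\<in>?G2. f (g,h) * carry k g h) * w k)"
    unfolding split_def by (subst sum.swap) (simp add: sum_distrib_right mult.assoc)
  also have "\<dots> = 0" by (intro sum.neutral) (simp add: carry0)
  finally show "f \<in> H" by simp
qed

end

section \<open>Explicit cocycles\<close>

definition binom2 :: "int \<Rightarrow> int" where
  "binom2 a = a * (a - 1) div 2"

lemma two_binom2: "2 * binom2 a = a * (a - 1)"
  by (simp add: binom2_def)

lemma binom2_add: "binom2 (a + b) = binom2 a + binom2 b + a * b"
proof -
  have "2 * binom2 (a + b) = 2 * (binom2 a + binom2 b + a * b)"
    by (simp add: two_binom2 distrib_left) (simp add: algebra_simps)
  then show ?thesis by simp
qed

lemma binom2_0_1 [simp]: "binom2 0 = 0" "binom2 1 = 0"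
  by (simp_all add: binom2_def)

lemma binom2_odd_dvd:
  assumes "odd m" shows "m dvd binom2 (m * q)"
proof -
  have "m dvd 2 * binom2 (m * q)" by (simp add: two_binom2)
  moreover have "coprime m 2" using assms by simp
  ultimately show ?thesis by (simp add: coprime_dvd_mult_right_iff)
qed

text \<open>Modulo m the value is -h * q: this residue is what spoils the Massey cocycles for even
  m.\<close>

lemma binom2_even:
  assumes "m = 2 * h" shows "binom2 (m * q) = m * (h * q * q) - h * q"
proof -
  have "2 * binom2 (m * q) = 2 * (m * (h * q * q) - h * q)"
    by (simp only: two_binom2) (simp add: assms algebra_simps)
  then show ?thesis by simp
qed

text \<open>a, b, c are the (1,2), (2,3), (1,3) entries of a Heisenberg matrix; no prime, one prime
  and two primes mark the three arguments. p, q, r belong to the product of the first two arguments,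
  p', q', r' to that of the last two.\<close>

locale heisenberg_cocycle =
  fixes m a b c a' b' c' a'' b'' c'' p q r p' q' r' :: int
  assumes ab: "p = (a + a') mod m" "q = (b + b') mod m" "r = (c + c' + a * b') mod m"
    and ab': "p' = (a' + a'') mod m" "q' = (b' + b'') mod m" "r' = (c' + c'' + a' * b'') mod m"
begin

lemma quotients:
  "p = a + a' - m * ((a + a') div m)" "q' = b' + b'' - m * ((b' + b'') div m)"
  "r = c + c' + a * b' - m * ((c + c' + a * b') div m)"
  "r' = c' + c'' + a' * b'' - m * ((c' + c'' + a' * b'') div m)"
  unfolding ab ab' by (simp_all add: minus_mult_div_eq_mod)

text \<open>The cochain a c' + binom2(a) b' represents the Massey product <x,x,y> and is an exact
  cocycle over the integers. The defect comes from reducing entries modulo m, and only the reduction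
  inside \<open>binom2\<close> can escape divisibility by m.\<close>

lemma left_defect:
  "\<exists>x. a' * c'' + binom2 a' * b'' - (p * c'' + binom2 p * b'') + (a * r' + binom2 a * q')
    - (a * c' + binom2 a * b') = m * x - binom2 (m * - ((a + a') div m)) * b''"
proof -
  define s where "s = (a + a') div m"
  define y where "y = (b' + b'') div m"
  define z where "z = (c' + c'' + a' * b'') div m"
  have p: "binom2 p = binom2 a + binom2 a' + a * a' + binom2 (m * - s) + (a + a') * (m * - s)"
    using binom2_add[of "a + a'" "m * - s"] unfolding quotients(1) s_def[symmetric]
    by (simp add: binom2_add)
  show ?thesis
    unfolding p s_def[symmetric] unfolding quotients(1,2,4) s_def[symmetric] y_def[symmetric] z_def[symmetric]
    \<comment> \<open>The witness collects the factors of m coming from the quotients s, y and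
      z.\<close>
    by (rule exI[of _ "s * c'' + (a + a') * s * b'' - a * z - binom2 a * y"]) (simp add: algebra_simps)
qed

text \<open>The mirror image: c b' + a binom2(b') represents <x,y,y>.\<close>

lemma right_defect:
  "\<exists>x. c' * b'' + a' * binom2 b'' - (r * b'' + p * binom2 b'') + (c * q' + a * binom2 q')
    - (c * b' + a * binom2 b') = m * x + a * binom2 (m * - ((b' + b'') div m))"
proof -
  define s where "s = (a + a') div m"
  define y where "y = (b' + b'') div m"
  define z where "z = (c + c' + a * b') div m"
  have q: "binom2 q' = binom2 b' + binom2 b'' + b' * b'' + binom2 (m * - y) + (b' + b'') * (m * - y)"
    using binom2_add[of "b' + b''" "m * - y"] unfolding quotients(2) y_def[symmetric]
    by (simp add: binom2_add)
  show ?thesis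
    unfolding q y_def[symmetric] unfolding quotients(1,2,3) s_def[symmetric] y_def[symmetric] z_def[symmetric]
    by (rule exI[of _ "z * b'' + s * binom2 b'' - c * y - a * (b' + b'') * y"]) (simp add: algebra_simps)
qed

lemma left_dvd:
  assumes "d dvd m" "\<And>x. d dvd binom2 (m * x)"
  shows "d dvd a' * c'' + binom2 a' * b'' - (p * c'' + binom2 p * b'') + (a * r' + binom2 a * q')
    - (a * c' + binom2 a * b')"
  using left_defect assms by (metis dvd_diff dvd_mult2)

lemma right_dvd:
  assumes "d dvd m" "\<And>x. d dvd binom2 (m * x)"
  shows "d dvd c' * b'' + a' * binom2 b'' - (r * b'' + p * binom2 b'') + (c * q' + a * binom2 q')
    - (c * b' + a * binom2 b')"
  using right_defect assms by (metis dvd_add dvd_mult dvd_mult2)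

text \<open>Both bracketings have the same unreduced central coordinate t, so its quotients by m
  cancel. What remains comes from reducing the two superdiagonal entries before multiplying.\<close>

lemma carry_defect:
  assumes m: "m \<noteq> 0"
  shows "(c' + c'' + a' * b'') div m - (r + c'' + p * b'') div m + (c + r' + a * q') div m - (c + c' + a * b') div m
    = (a + a') div m * b'' - a * ((b' + b'') div m)"
proof -
  define s where "s = (a + a') div m"
  define y where "y = (b' + b'') div m"
  define z where "z = (c + c' + a * b') div m"
  define z' where "z' = (c' + c'' + a' * b'') div m"
  define t where "t = c + c' + c'' + a * b' + a * b'' + a' * b''"
  have "r + c'' + p * b'' = t + m * (- z - s * b'')"
    unfolding quotients(1,3) s_def[symmetric] z_def[symmetric] by (simp add: t_def algebra_simps)
  then have 1: "(r + c'' + p * b'') div m = t div m - z - s * b''" using m by simp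
  have "c + r' + a * q' = t + m * (- z' - a * y)"
    unfolding quotients(2,4) y_def[symmetric] z'_def[symmetric] by (simp add: t_def algebra_simps)
  then have "(c + r' + a * q') div m = t div m - z' - a * y" using m by simp
  with 1 show ?thesis unfolding s_def y_def z_def z'_def by simp
qed

text \<open>For even \<open>m\<close> the left and right cocycles fail modulo \<open>m\<close> by multiples of \<open>m/2\<close>: these are
  Bockstein classes whose difference is the defect of the carry in the central coordinate.\<close>

lemma balanced_dvd:
  assumes m: "m = 2 * h" "m \<noteq> 0"
  shows "m dvd (a' * c'' + binom2 a' * b'' + c' * b'' + a' * binom2 b'' + h * ((c' + c'' + a' * b'') div m))
    - (p * c'' + binom2 p * b'' + r * b'' + p * binom2 b'' + h * ((r + c'' + p * b'') div m))
    + (a * r' + binom2 a * q' + c * q' + a * binom2 q' + h * ((c + r' + a * q') div m))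
    - (a * c' + binom2 a * b' + c * b' + a * binom2 b' + h * ((c + c' + a * b') div m))" (is "m dvd ?E")
proof -
  define s where "s = (a + a') div m"
  define y where "y = (b' + b'') div m"
  obtain x where x: "a' * c'' + binom2 a' * b'' - (p * c'' + binom2 p * b'') + (a * r' + binom2 a * q')
    - (a * c' + binom2 a * b') = m * x - binom2 (m * - s) * b''"
    using left_defect unfolding s_def by blast
  obtain x' where x': "c' * b'' + a' * binom2 b'' - (r * b'' + p * binom2 b'') + (c * q' + a * binom2 q')
    - (c * b' + a * binom2 b') = m * x' + a * binom2 (m * - y)"
    using right_defect unfolding y_def by blast
  have "h * ((c' + c'' + a' * b'') div m) - h * ((r + c'' + p * b'') div m) + h * ((c + r' + a * q') div m)
      - h * ((c + c' + a * b') div m) = h * (s * b'' - a * y)"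
    using carry_defect[OF m(2)] unfolding s_def y_def
    by (metis right_diff_distrib distrib_left)
  with x x' have "?E = (m * x - binom2 (m * - s) * b'') + (m * x' + a * binom2 (m * - y)) + h * (s * b'' - a * y)"
    by linarith
  also have "\<dots> = m * (x + x' - h * s * s * b'' + a * h * y * y)"
    unfolding binom2_even[OF m(1)] by (simp add: algebra_simps)
  finally show ?thesis by simp
qed

end

text \<open>Here a, b are entries of g; A, B, C of h; X, Y, Z of k; p, s of the product gh; q, r, z
  of hk. The number is the row within a 4 by 4 block, and A, B, C as well as X, Y, Z run through
  distance 1, 2, 3 from the diagonal.\<close>

lemma cross_even:
  fixes a1 :: int
  assumes "even p1 \<longleftrightarrow> even (a1 + A1)" "even p2 \<longleftrightarrow> even (a2 + A2)" "even s1 \<longleftrightarrow> even (b1 + B1 + a1 * A2)"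
    and "even q3 \<longleftrightarrow> even (A3 + X3)" "even r2 \<longleftrightarrow> even (B2 + Y2 + A2 * X3)"
      "even z \<longleftrightarrow> even (C + Z + A1 * Y2 + B1 * X3)"
  shows "even ((A2 * B1 * X3 + A1 * A2 * Y2 + A2 * Z + A1 * Y2 + B1 * Y2)
    - (p2 * s1 * X3 + p1 * p2 * Y2 + p2 * Z + p1 * Y2 + s1 * Y2)
    + (a2 * b1 * q3 + a1 * a2 * r2 + a2 * z + a1 * r2 + b1 * r2)
    - (a2 * b1 * A3 + a1 * a2 * B2 + a2 * C + a1 * B2 + b1 * B2))"
  by (cases "even a1"; cases "even a2"; cases "even A2"; cases "even X3"; cases "even Y2")
     (simp_all add: assms, blast+)

section \<open>The Schur multiplier of the unitriangular group\<close>

datatype gen_index = Far nat nat | Left nat | Right nat | Cross nat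

text \<open>Pairs are grouped by the larger index. Truncated \<open>j - 1\<close> gives no pairs for
  j = 0 and j = 1.\<close>

primrec far_list :: "nat \<Rightarrow> gen_index list" where
  "far_list 0 = []"
| "far_list (Suc j) = far_list j @ map (\<lambda>i. Far i j) [0..<j - 1]"

lemma length_far_list: "length (far_list k) = (k - 1) choose 2"
proof (induction k)
  case (Suc k)
  then show ?case by (cases k) (simp_all add: numeral_2_eq_2)
qed (simp add: numeral_2_eq_2)

lemma set_far_list: "set (far_list k) = {Far i j | i j. Suc i < j \<and> j < k}"
  by (induction k) (auto simp: less_Suc_eq)

lemma distinct_far_list: "distinct (far_list k)"
  by (induction k) (auto simp: set_far_list distinct_map inj_on_def)

section \<open>Generators, dual cocycles and orders\<close>

context unitriangular
begin

lemma mult_entry_1: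
  "g \<in> carrier U \<Longrightarrow> h \<in> carrier U \<Longrightarrow> i + 1 < n \<Longrightarrow>
    (g \<otimes>\<^bsub>U\<^esub> h) i (i+1) = (g i (i+1) + h i (i+1)) mod m"
proof -
  have "{i<..<i+1} = {}" by auto
  then show "g \<in> carrier U \<Longrightarrow> h \<in> carrier U \<Longrightarrow> i + 1 < n \<Longrightarrow> ?thesis"
    by (simp add: UT_mult_entry)
qed

lemma mult_entry_2:
  "g \<in> carrier U \<Longrightarrow> h \<in> carrier U \<Longrightarrow> i + 2 < n \<Longrightarrow>
    (g \<otimes>\<^bsub>U\<^esub> h) i (i+2) = (g i (i+2) + h i (i+2) + g i (i+1) * h (i+1) (i+2)) mod m"
proof -
  have "{i<..<i+2} = {i+1}" by auto
  then show "g \<in> carrier U \<Longrightarrow> h \<in> carrier U \<Longrightarrow> i + 2 < n \<Longrightarrow> ?thesis"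
    by (simp add: UT_mult_entry)
qed

lemma mult_entry_3:
  "g \<in> carrier U \<Longrightarrow> h \<in> carrier U \<Longrightarrow> i + 3 < n \<Longrightarrow>
    (g \<otimes>\<^bsub>U\<^esub> h) i (i+3)
      = (g i (i+3) + h i (i+3) + g i (i+1) * h (i+1) (i+3) + g i (i+2) * h (i+2) (i+3)) mod m"
proof -
  have "{i<..<i+3} = {i+1, i+2}" by auto
  then show "g \<in> carrier U \<Longrightarrow> h \<in> carrier U \<Longrightarrow> i + 3 < n \<Longrightarrow> ?thesis"
    by (simp add: UT_mult_entry add.assoc)
qed

text \<open>For odd m a crossing class is killed by both 2 and m, hence trivial.\<close>

fun valid :: "gen_index \<Rightarrow> bool" where
  "valid (Far i j) \<longleftrightarrow> Suc i < j \<and> Suc j < n"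
| "valid (Left i) \<longleftrightarrow> i + 2 < n"
| "valid (Right i) \<longleftrightarrow> i + 2 < n"
| "valid (Cross i) \<longleftrightarrow> i + 3 < n \<and> even m"

fun modulus :: "gen_index \<Rightarrow> int" where
  "modulus (Far i j) = m"
| "modulus (Left i) = (if even m then m div 2 else m)"
| "modulus (Right i) = m"
| "modulus (Cross i) = 2"

text \<open>For even m the left torus is traded for minus the sum of the left and right tori, whose
  m/2-fold multiple bounds. The minus sign gives pairing 1 with \<open>left_cocycle\<close>, whose
  value is 1 on (e i (i+1), e i (i+2)).\<close>

fun gen_cycle :: "gen_index \<Rightarrow> (nat \<Rightarrow> nat \<Rightarrow> int) \<times> (nat \<Rightarrow> nat \<Rightarrow> int) \<Rightarrow> int" where
  "gen_cycle (Far i j) = torus (e i (i+1)) (e j (j+1))"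
| "gen_cycle (Left i) = - torus (e i (i+2)) (e i (i+1))
     - (if even m then torus (e i (i+2)) (e (i+1) (i+2)) else 0)"
| "gen_cycle (Right i) = torus (e i (i+2)) (e (i+1) (i+2))"
| "gen_cycle (Cross i) = torus (e i (i+2)) (e (i+1) (i+3))"

definition left_cocycle where
  "left_cocycle i g h = g i (i+1) * h i (i+2) + binom2 (g i (i+1)) * h (i+1) (i+2)"

definition right_cocycle where
  "right_cocycle i g h = g i (i+2) * h (i+1) (i+2) + g i (i+1) * binom2 (h (i+1) (i+2))"

definition carry_cochain where
  "carry_cochain i g h = (g i (i+2) + h i (i+2) + g i (i+1) * h (i+1) (i+2)) div m"

text \<open>The term g i (i+2) * h (i+1) (i+3) detects the crossing torus. The crossing relation
  then forces an odd value on the nested torus as well. For even m the three terms containing g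
  (i+1) (i+2) amount, modulo 2, to that entry times the increase of entry (i, i+3) from g to
  gh.\<close>

definition cross_cocycle where
  "cross_cocycle i g h = g (i+1) (i+2) * g i (i+2) * h (i+2) (i+3) + g i (i+1) * g (i+1) (i+2) * h (i+1) (i+3)
     + g (i+1) (i+2) * h i (i+3) + g i (i+1) * h (i+1) (i+3) + g i (i+2) * h (i+1) (i+3)"

text \<open>For even m neither the left nor the right cochain is a cocycle modulo m. Their sum
  becomes one after adding m/2 times the central carry, and it vanishes on the Left cycle of the
  same index.\<close>

fun gen_cocycle :: "gen_index \<Rightarrow> (nat \<Rightarrow> nat \<Rightarrow> int) \<Rightarrow> (nat \<Rightarrow> nat \<Rightarrow> int) \<Rightarrow> int" where
  "gen_cocycle (Far i j) g h = g i (i+1) * h j (j+1)"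
| "gen_cocycle (Left i) g h = left_cocycle i g h"
| "gen_cocycle (Right i) g h = right_cocycle i g h
     + (if even m then left_cocycle i g h + m div 2 * carry_cochain i g h else 0)"
| "gen_cocycle (Cross i) g h = cross_cocycle i g h"

lemma modulus_pos: "valid x \<Longrightarrow> 0 < modulus x"
  using m_ge_2 by (cases x) auto

lemma gen_cocycle_dvd:
  assumes x: "valid x" and ghk: "g \<in> carrier U" "h \<in> carrier U" "k \<in> carrier U"
  shows "modulus x dvd gen_cocycle x h k - gen_cocycle x (g \<otimes>\<^bsub>U\<^esub> h) k
    + gen_cocycle x g (h \<otimes>\<^bsub>U\<^esub> k) - gen_cocycle x g h"
proof -
  have heis: "heisenberg_cocycle m (g i (i+1)) (g (i+1) (i+2)) (g i (i+2)) (h i (i+1)) (h (i+1) (i+2)) (h i (i+2))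
      (k i (i+1)) (k (i+1) (i+2)) (k i (i+2))
      ((g \<otimes>\<^bsub>U\<^esub> h) i (i+1)) ((g \<otimes>\<^bsub>U\<^esub> h) (i+1) (i+2)) ((g \<otimes>\<^bsub>U\<^esub> h) i (i+2))
      ((h \<otimes>\<^bsub>U\<^esub> k) i (i+1)) ((h \<otimes>\<^bsub>U\<^esub> k) (i+1) (i+2)) ((h \<otimes>\<^bsub>U\<^esub> k) i (i+2))"
    if "i + 2 < n" for i
    using that ghk mult_entry_1[of g h i] mult_entry_1[of h k i] mult_entry_1[of g h "i+1"]
      mult_entry_1[of h k "i+1"] mult_entry_2[of g h i] mult_entry_2[of h k i]
    by unfold_locales simp_all
  show ?thesis
  proof (cases x)
    case (Far i j)
    define s where "s = (g i (i+1) + h i (i+1)) div m"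
    define y where "y = (h j (j+1) + k j (j+1)) div m"
    have eqs: "(g \<otimes>\<^bsub>U\<^esub> h) i (i+1) = g i (i+1) + h i (i+1) - m * s"
      "(h \<otimes>\<^bsub>U\<^esub> k) j (j+1) = h j (j+1) + k j (j+1) - m * y"
      using x ghk Far mult_entry_1[of g h i] mult_entry_1[of h k j]
      by (simp_all add: s_def y_def minus_mult_div_eq_mod)
    have "gen_cocycle x h k - gen_cocycle x (g \<otimes>\<^bsub>U\<^esub> h) k
        + gen_cocycle x g (h \<otimes>\<^bsub>U\<^esub> k) - gen_cocycle x g h = m * (s * k j (j+1) - g i (i+1) * y)"
      unfolding Far gen_cocycle.simps eqs by (simp add: algebra_simps)
    then show ?thesis by (simp add: Far)
  next
    case (Left i)
    interpret heisenberg_cocycle m "g i (i+1)" "g (i+1) (i+2)" "g i (i+2)" "h i (i+1)" "h (i+1) (i+2)" "h i (i+2)"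
      "k i (i+1)" "k (i+1) (i+2)" "k i (i+2)"
      "(g \<otimes>\<^bsub>U\<^esub> h) i (i+1)" "(g \<otimes>\<^bsub>U\<^esub> h) (i+1) (i+2)" "(g \<otimes>\<^bsub>U\<^esub> h) i (i+2)"
      "(h \<otimes>\<^bsub>U\<^esub> k) i (i+1)" "(h \<otimes>\<^bsub>U\<^esub> k) (i+1) (i+2)" "(h \<otimes>\<^bsub>U\<^esub> k) i (i+2)"
      using x Left by (intro heis) simp
    \<comment> \<open>Odd m divides these binomials; for even m they are multiples of m/2 only,
      which accounts for the halved modulus.\<close>
    have "modulus x dvd m" "modulus x dvd binom2 (m * z)" for z
      by (auto simp: Left binom2_odd_dvd binom2_even[of m "m div 2"])
    from left_dvd[OF this] show ?thesis
      by (simp add: Left left_cocycle_def)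
  next
    case (Right i)
    interpret heisenberg_cocycle m "g i (i+1)" "g (i+1) (i+2)" "g i (i+2)" "h i (i+1)" "h (i+1) (i+2)" "h i (i+2)"
      "k i (i+1)" "k (i+1) (i+2)" "k i (i+2)"
      "(g \<otimes>\<^bsub>U\<^esub> h) i (i+1)" "(g \<otimes>\<^bsub>U\<^esub> h) (i+1) (i+2)" "(g \<otimes>\<^bsub>U\<^esub> h) i (i+2)"
      "(h \<otimes>\<^bsub>U\<^esub> k) i (i+1)" "(h \<otimes>\<^bsub>U\<^esub> k) (i+1) (i+2)" "(h \<otimes>\<^bsub>U\<^esub> k) i (i+2)"
      using x Right by (intro heis) simp
    show ?thesis
    proof (cases "even m")
      case True
      then show ?thesis
        using balanced_dvd[of "m div 2"] m_ge_2
        by (simp add: Right left_cocycle_def right_cocycle_def carry_cochain_def algebra_simps)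
    next
      case False
      then show ?thesis
        using right_dvd[of m] by (simp add: Right right_cocycle_def binom2_odd_dvd)
    qed
  next
    case (Cross i)
    \<comment> \<open>Reduction modulo an even m preserves parity.\<close>
    have par: "even (z mod m) \<longleftrightarrow> even z" for z :: int
      using x Cross by (simp add: dvd_mod_iff)
    have "even (gen_cocycle x h k - gen_cocycle x (g \<otimes>\<^bsub>U\<^esub> h) k
      + gen_cocycle x g (h \<otimes>\<^bsub>U\<^esub> k) - gen_cocycle x g h)"
      unfolding Cross gen_cocycle.simps cross_cocycle_def
    proof (rule cross_even)
      show "even ((g \<otimes>\<^bsub>U\<^esub> h) i (i+1)) = even (g i (i+1) + h i (i+1))"
        "even ((g \<otimes>\<^bsub>U\<^esub> h) i (i+2)) = even (g i (i+2) + h i (i+2) + g i (i+1) * h (i+1) (i+2))"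
        "even ((h \<otimes>\<^bsub>U\<^esub> k) i (i+3)) = even (h i (i+3) + k i (i+3) + h i (i+1) * k (i+1) (i+3) + h i (i+2) * k (i+2) (i+3))"
        using x Cross ghk mult_entry_1[of g h i] mult_entry_2[of g h i] mult_entry_3[of h k i]
        by (simp_all add: par)
      show "even ((g \<otimes>\<^bsub>U\<^esub> h) (i+1) (i+2)) = even (g (i+1) (i+2) + h (i+1) (i+2))"
        "even ((h \<otimes>\<^bsub>U\<^esub> k) (i+2) (i+3)) = even (h (i+2) (i+3) + k (i+2) (i+3))"
        "even ((h \<otimes>\<^bsub>U\<^esub> k) (i+1) (i+3)) = even (h (i+1) (i+3) + k (i+1) (i+3) + h (i+1) (i+2) * k (i+2) (i+3))"
        using x Cross ghk mult_entry_1[of g h "i+1"] mult_entry_1[of h k "i+2"] mult_entry_2[of h k "i+1"]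
        by (simp_all add: par eval_nat_numeral)
    qed
    then show ?thesis by (simp add: Cross)
  qed
qed

lemma e_entry: "r < c \<Longrightarrow> c < n \<Longrightarrow> e i j r c = (if r = i \<and> c = j then 1 else 0)"
  by (simp add: el_def)

lemma torus_cycle:
  assumes gh: "g \<in> carrier U" "h \<in> carrier U" and c: "g \<otimes>\<^bsub>U\<^esub> h = h \<otimes>\<^bsub>U\<^esub> g"
  shows "torus g h \<in> cycles2 U"
proof -
  interpret group U by (rule group_UT)
  have "torus g h \<in> chains2 U"
    using gh by (auto simp: torus_def chains2_def basis_chain_def fun_apply)
  then show ?thesis
    unfolding cycles2_iff bar_d2_eq_pairing torus_def pairing_diff
    using gh by (simp add: pairing_basis finite_UT c)
qed

lemma cycles2_uminus: "f \<in> cycles2 G \<Longrightarrow> - f \<in> cycles2 G"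
  using cycles2_of_int_mult[of f G "-1"] by simp

lemma gen_cycle_cycle: assumes "valid x" shows "gen_cycle x \<in> cycles2 U"
proof -
  have tor: "torus (e i j) (e k l) \<in> cycles2 U"
    if "i < j" "j < n" "k < l" "l < n" "j \<noteq> k" "i \<noteq> l" for i j k l
    using that by (intro torus_cycle e_comm) auto
  have diff: "f - f' \<in> cycles2 U" if "f \<in> cycles2 U" "f' \<in> cycles2 U" for f f'
    using cycles2_add[OF that(1) cycles2_uminus[OF that(2)]] by simp
  show ?thesis
    using assms by (cases x) (auto intro!: tor diff cycles2_uminus cycles2_zero)
qed

lemma pairing_torus:
  assumes "i < j" "k < l"
  shows "pairing U c (torus (e i j) (e k l)) = c (e i j) (e k l) - c (e k l) (e i j)"
proof -
  interpret group U by (rule group_UT)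
  show ?thesis using assms by (simp add: torus_def pairing_diff pairing_basis finite_UT)
qed

lemma left_cocycle_e:
  "s + 2 < n \<Longrightarrow> left_cocycle s (e i j) (e k l) = (if i = s \<and> j = s+1 \<and> k = s \<and> l = s+2 then 1 else 0)"
  by (auto simp: left_cocycle_def e_entry)

lemma right_cocycle_e:
  "s + 2 < n \<Longrightarrow> right_cocycle s (e i j) (e k l) = (if i = s \<and> j = s+2 \<and> k = s+1 \<and> l = s+2 then 1 else 0)"
  by (auto simp: right_cocycle_def e_entry)

text \<open>Equal matrices are excluded because for m = 2 the pair of two copies of
  \<open>e s (s+2)\<close> carries.\<close>

lemma carry_cochain_e:
  "s + 2 < n \<Longrightarrow> i \<noteq> k \<or> j \<noteq> l \<Longrightarrow> carry_cochain s (e i j) (e k l) = 0"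
  using m_ge_2 by (auto simp: carry_cochain_def e_entry)

lemma cross_cocycle_e:
  "s + 3 < n \<Longrightarrow> cross_cocycle s (e i j) (e k l)
    = (if i = s+1 \<and> j = s+2 \<and> k = s \<and> l = s+3 \<or> i = s \<and> j = s+1 \<and> k = s+1 \<and> l = s+3
         \<or> i = s \<and> j = s+2 \<and> k = s+1 \<and> l = s+3 then 1 else 0)"
  by (auto simp: cross_cocycle_def e_entry)

lemma pairing_uminus: "pairing G c (- f) = - pairing G c f"
  using pairing_of_int_mult[of G c "-1" f] by simp

lemma gen_dual:
  assumes "valid x" "valid y"
  shows "pairing U (gen_cocycle x) (gen_cycle y) = (if x = y then 1 else 0)"
  using assms
  by (cases x; cases y)
     (auto simp: pairing_diff pairing_uminus pairing_torus left_cocycle_e right_cocycle_e carry_cochain_e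
       cross_cocycle_e e_entry)

lemma gen_torsion:
  assumes x: "valid x"
  shows "of_int (modulus x) * gen_cycle x \<in> boundaries2 U"
proof -
  interpret U: group U by (rule group_UT)
  interpret unitriangular_cocycle n m "\<lambda>g h. basis_chain (g, h)" "boundaries2 U"
    by unfold_locales (use U.bar_d3_basis[OF finite_UT] boundaries2_diff boundaries2_zero in auto)
  have tau: "tau g h = torus g h" for g h by (simp add: tau_def torus_def)
  have tors: "of_int m * torus (e i j) (e k l) \<in> boundaries2 U"
    if "i < j" "j < n" "k < l" "l < n" "j \<noteq> k" "i \<noteq> l" for i j k l
    using e_tau_torsion[OF that] m_ge_2 by (simp add: tau)
  show ?thesis
  proof (cases x)
    case (Left i)
    have a: "of_int m * torus (e i (i+2)) (e i (i+1)) \<in> boundaries2 U"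
      "of_int m * torus (e i (i+2)) (e (i+1) (i+2)) \<in> boundaries2 U"
      using x Left by (intro tors; simp)+
    show ?thesis
    proof (cases "even m")
      case True
      define h where "h = m div 2"
      have m: "m = 2 * h" using True by (simp add: h_def)
      let ?z = "torus (e i (i+2)) (e i (i+1))" and ?z' = "torus (e i (i+2)) (e (i+1) (i+2))"
      have C: "of_nat (nat m choose 2) = (of_int (h * (m - 1)) :: (nat \<Rightarrow> nat \<Rightarrow> int) \<times> (nat \<Rightarrow> nat \<Rightarrow> int) \<Rightarrow> int)"
      proof -
        have "2 * int (nat m choose 2) = m * (m - 1)"
        proof -
          have "2 * (nat m choose 2) = nat m * (nat m - 1)"
            using times_binomial_minus1_eq[of 2 "nat m"] by simp
          then have "int (2 * (nat m choose 2)) = int (nat m * (nat m - 1))" by (simp only:)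
          then show ?thesis using m_ge_2 by (simp add: of_nat_diff)
        qed
        then have "int (nat m choose 2) = h * (m - 1)" by (simp add: m)
        then show ?thesis by (metis of_int_of_nat_eq)
      qed
      have "of_nat (nat m choose 2) * (- ?z + ?z') \<in> boundaries2 U"
        using e_tau_heisenberg[of i] x Left tau_swap[of "e i (i+2)"]
        by (simp add: tau)
      then have b: "of_int (h * (m - 1)) * (- ?z + ?z') \<in> boundaries2 U" unfolding C .
      have "of_int m * (?z' - ?z) \<in> boundaries2 U"
        unfolding right_diff_distrib by (rule boundaries2_diff[OF a(2,1)])
      \<comment> \<open>Since h m - h (m - 1) = h, the first difference is h times ?z' - ?z.
        Subtracting m ?z' = 2 h ?z' then flips the sign of ?z'.\<close>
      from boundaries2_diff[OF boundaries2_diff[OF boundaries2_of_int_mult[OF this, of h] b] a(2)]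
      have "of_int h * (of_int m * (?z' - ?z)) - of_int (h * (m - 1)) * (- ?z + ?z') - of_int m * ?z' \<in> boundaries2 U" .
      also have "of_int h * (of_int m * (?z' - ?z)) - of_int (h * (m - 1)) * (- ?z + ?z') - of_int m * ?z'
          = of_int h * (- ?z - ?z')"
        by (simp add: m algebra_simps)
      finally show ?thesis using True by (simp add: Left h_def)
    next
      case False
      have "of_int (-1) * (of_int m * torus (e i (i+2)) (e i (i+1))) \<in> boundaries2 U"
        by (rule boundaries2_of_int_mult[OF a(1)])
      then show ?thesis using False by (simp add: Left)
    qed
  next
    case (Cross i)
    then show ?thesis using e_tau_two_torsion[of i] x by (simp add: tau)
  qed (use x in \<open>auto intro!: tors\<close>)
qed

lemma gen_generate:
  assumes H: "0 \<in> H" "\<And>x y. x \<in> H \<Longrightarrow> y \<in> H \<Longrightarrow> x - y \<in> H" "boundaries2 U \<subseteq> H"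
    and gen: "\<And>x. valid x \<Longrightarrow> gen_cycle x \<in> H"
  shows "cycles2 U \<subseteq> H"
proof (rule cycles2_generated_by_tori[OF H])
  interpret U: group U by (rule group_UT)
  interpret unitriangular_cocycle n m "\<lambda>g h. basis_chain (g, h)" H
    by unfold_locales (use U.bar_d3_basis[OF finite_UT] H in auto)
  have tau: "tau g h = torus g h" for g h by (simp add: tau_def torus_def)
  show "torus (e i (Suc i)) (e j (Suc j)) \<in> H" if "Suc i < j" "Suc j < n" for i j
    using gen[of "Far i j"] that by simp
  show right: "torus (e i (i+2)) (e (i+1) (i+2)) \<in> H" if "i + 2 < n" for i
    using gen[of "Right i"] that by simp
  show "torus (e i (i+2)) (e i (i+1)) \<in> H" if i: "i + 2 < n" for i
  proof (cases "even m")
    case True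
    have "- torus (e i (i+2)) (e i (i+1)) - torus (e i (i+2)) (e (i+1) (i+2)) \<in> H"
      using gen[of "Left i"] i True by simp
    from H_uminus[OF H_add[OF this right[OF i]]] show ?thesis by simp
  next
    case False
    then show ?thesis using H_uminus[OF gen[of "Left i"]] i by simp
  qed
  show "torus (e i (i+2)) (e (i+1) (i+3)) \<in> H" if i: "i + 3 < n" for i
  proof (cases "even m")
    case True
    then show ?thesis using gen[of "Cross i"] i by simp
  next
    case False
    let ?t = "torus (e i (i+2)) (e (i+1) (i+3))"
    obtain q where q: "m = 2 * q + 1" using False by (metis oddE)
    have "of_int m * ?t \<in> H"
      using e_tau_torsion[of i "i+2" "i+1" "i+3"] i m_ge_2 by (simp add: tau)
    moreover have "of_int q * (2 * ?t) \<in> H"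
      using e_tau_two_torsion[OF i] by (intro H_of_int_mult) (simp add: tau)
    \<comment> \<open>m - 2 q = 1, so the m-fold and 2-fold multiples together yield the class
      itself.\<close>
    ultimately have "of_int m * ?t - of_int q * (2 * ?t) \<in> H" by (rule H_diff)
    then show ?thesis by (simp add: q algebra_simps)
  qed
qed

theorem schur_multiplier_UT:
  assumes dist: "distinct idx" and idx: "set idx = Collect valid"
  shows "schur_multiplier U \<cong> cyc_prod (map modulus idx)"
proof -
  interpret group U by (rule group_UT)
  show ?thesis
  proof (rule schur_multiplier_dual_basis[where c = gen_cocycle and t = gen_cycle])
    show "cycles2 U \<subseteq> H"
      if "0 \<in> H" "\<And>x y. x \<in> H \<Longrightarrow> y \<in> H \<Longrightarrow> x - y \<in> H" "boundaries2 U \<subseteq> H" "gen_cycle ` set idx \<subseteq> H" for H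
      using that by (intro gen_generate) (auto simp: idx)
  qed (use dist in \<open>auto simp: idx finite_UT modulus_pos gen_cocycle_dvd gen_cycle_cycle gen_dual gen_torsion\<close>)
qed

end

theorem mainTheorem4:
  fixes n :: nat and m :: int
  assumes "n \<ge> 3" and "m \<ge> 2"
  shows "schur_multiplier (UT n m) \<cong>
           cyc_prod (if odd m then replicate ((n choose 2) - 1) m
                     else replicate (n - 3) 2 @ replicate (n - 2) (m div 2)
                          @ replicate ((n - 1) choose 2) m)"
proof -
  interpret unitriangular n m by unfold_locales (rule assms)
  let ?heis = "map Left [0..<n - 2]" and ?rest = "map Right [0..<n - 2] @ far_list (n - 1)"
  \<comment> \<open>The argument n - 1 expresses the bound j + 1 < n on the larger index.\<close>
  have far: "map modulus (far_list (n - 1)) = replicate (n - 2 choose 2) m"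
    by (rule replicate_eqI) (auto simp: length_far_list set_far_list numeral_2_eq_2)
  have map_rep: "map (modulus \<circ> f) [0..<k] = replicate k d" if "\<And>i. modulus (f i) = d" for f d and k :: nat
    using that by (intro replicate_eqI) auto
  obtain k where n: "n = Suc (Suc (Suc k))"
    using le_Suc_ex[OF assms(1)] by (auto simp: numeral_3_eq_3)
  \<comment> \<open>\<open>Right\<close> and \<open>Far\<close> together account for
    \<open>n - 1 choose 2\<close> factors; for odd m the n - 2 factors of \<open>Left\<close> bring
    the count to (n choose 2) - 1.\<close>
  have c1: "n - 1 choose 2 = (n - 2) + (n - 2 choose 2)" and c2: "(n choose 2) - 1 = (n - 2) + (n - 1 choose 2)"
    unfolding n by (simp_all add: numeral_2_eq_2)
  show ?thesis
  proof (cases "odd m")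
    case True
    have "schur_multiplier U \<cong> cyc_prod (map modulus (?heis @ ?rest))"
    proof (rule schur_multiplier_UT)
      show "distinct (?heis @ ?rest)"
        by (auto simp: distinct_map inj_on_def distinct_far_list set_far_list)
      show "set (?heis @ ?rest) = Collect valid"
      proof (rule Set.set_eqI)
        fix x show "x \<in> set (?heis @ ?rest) \<longleftrightarrow> x \<in> Collect valid"
          using True by (cases x) (auto simp: set_far_list image_iff)
      qed
    qed
    also have "map modulus (?heis @ ?rest)
        = replicate (n - 2) m @ replicate (n - 2) m @ replicate (n - 2 choose 2) m"
      using True far by (simp add: map_rep)
    also have "\<dots> = replicate ((n choose 2) - 1) m"
      unfolding c2 c1 replicate_add ..
    finally show ?thesis using True by simp
  next
    case False
    \<comment> \<open>The order of this list matches the order of the claimed cyclic factors: 2,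
      then m/2, then m.\<close>
    let ?idx = "map Cross [0..<n - 3] @ ?heis @ ?rest"
    have "schur_multiplier U \<cong> cyc_prod (map modulus ?idx)"
    proof (rule schur_multiplier_UT)
      show "distinct ?idx"
        by (auto simp: distinct_map inj_on_def distinct_far_list set_far_list)
      show "set ?idx = Collect valid"
      proof (rule Set.set_eqI)
        fix x show "x \<in> set ?idx \<longleftrightarrow> x \<in> Collect valid"
          using False by (cases x) (auto simp: set_far_list image_iff)
      qed
    qed
    also have "map modulus ?idx = replicate (n - 3) 2 @ replicate (n - 2) (m div 2)
        @ replicate (n - 2) m @ replicate (n - 2 choose 2) m"
      using False far by (simp add: map_rep)
    also have "\<dots> = replicate (n - 3) 2 @ replicate (n - 2) (m div 2) @ replicate ((n - 1) choose 2) m"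
      unfolding c1 replicate_add ..
    finally show ?thesis using False by simp
  qed
qed

end
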